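(* Let $X\sim N(\theta^*,\sigma^2I_n)$ and let $\widehat{\theta}^{(iso)}=\widehat\theta(\Theta_n^\uparrow)$ be the isotonic least-squares estimator. There exists a universal constant $c>0$ such that for all $n$ and all $k\in[n]$, $$\sup_{\theta^*\in\Theta_{k}^{\uparrow}}\mathbb{E}\|\widehat{\theta}^{(iso)}-\theta^*\|^2\geq c\sigma^2k\log(en/k).$$
   Context: $[n]=\{1,\dots,n\}$. For reals $a\le b$, $(a:b]$ is the set of integers $i$ with $a<i\le b$. For $k\in[n]$, $\Theta_k^{\uparrow}$ is the set of $\theta\in\mathbb{R}^n$ for which there exist integers $0=a_0\le a_1\le\cdots\le a_k=n$ and reals $\mu_1\le\cdots\le\mu_k$ with $\theta_i=\mu_j$ for all $i\in(a_{j-1}:a_j]$. In particular $\Theta_n^\uparrow=\{\theta:\theta_1\le\cdots\le\theta_n\}$, and $\widehat\theta^{(iso)}=\arg\min_{\theta_1\le\cdots\le\theta_n}\|X-\theta\|^2$. *)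

theory Defs
  imports "HOL-Probability.Probability"
begin

text \<open>Vectors in R^n are represented as functions nat => real, extensional on {1..n}.\<close>

definition Theta_up :: "nat \<Rightarrow> nat \<Rightarrow> (nat \<Rightarrow> real) set" where
  "Theta_up n k = {\<theta> \<in> extensional {1..n}.
     \<exists>(a::nat \<Rightarrow> nat) (\<mu>::nat \<Rightarrow> real).
        a 0 = 0 \<and> a k = n \<and> (\<forall>j. 1 \<le> j \<and> j \<le> k \<longrightarrow> a (j - 1) \<le> a j) \<and>
        (\<forall>j. 1 \<le> j \<and> j < k \<longrightarrow> \<mu> j \<le> \<mu> (j + 1)) \<and>
        (\<forall>j i. 1 \<le> j \<and> j \<le> k \<and> a (j - 1) < i \<and> i \<le> a j \<longrightarrow> \<theta> i = \<mu> j)}"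

definition sqdist_n :: "nat \<Rightarrow> (nat \<Rightarrow> real) \<Rightarrow> (nat \<Rightarrow> real) \<Rightarrow> real" where
  "sqdist_n n x y = (\<Sum>i\<in>{1..n}. (x i - y i)\<^sup>2)"

definition iso_est :: "nat \<Rightarrow> (nat \<Rightarrow> real) \<Rightarrow> (nat \<Rightarrow> real)" where
  "iso_est n x = (THE \<theta>. \<theta> \<in> Theta_up n n \<and>
      (\<forall>\<eta>\<in>Theta_up n n. sqdist_n n x \<theta> \<le> sqdist_n n x \<eta>))"

definition gauss_n :: "nat \<Rightarrow> (nat \<Rightarrow> real) \<Rightarrow> real \<Rightarrow> (nat \<Rightarrow> real) measure" where
  "gauss_n n \<theta> \<sigma> = PiM {1..n} (\<lambda>i. density lborel (normal_density (\<theta> i) \<sigma>))"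

end

theory Submission
  imports Defs
begin

text \<open>Take the true signal to be a staircase with \<open>k\<close> steps of length about \<open>n/k\<close> and height \<open>N\<close>.
  When the noise is below \<open>N/2\<close> the isotonic fit decouples into independent isotonic regressions
  of the pure noise on the steps; letting \<open>N \<rightarrow> \<infinity>\<close> (monotone convergence) the risk is thus at least
  the sum over the steps of the risk for pure noise. For pure noise \<open>w\<close> on a step, the fit \<open>\<theta>\<close>
  satisfies \<open>\<parallel>\<theta>\<parallel>\<^sup>2 \<ge> 2\<langle>w, u\<rangle> - \<parallel>u\<parallel>\<^sup>2\<close> for every monotone \<open>u\<close>. Cut the step into \<open>L \<approx> log\<^sub>1\<^sub>2\<^sub>8 (n/k)\<close>
  consecutive pieces whose lengths decrease by the factor \<open>64\<close>, and take for \<open>u\<close> the running maximum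
  of the piece averages: every piece contributes its squared normalised sum, of expectation \<open>1\<close>,
  while the penalties paid for making \<open>u\<close> monotone have expectation below \<open>4/5\<close> per piece.
  Hence each step contributes at least \<open>\<sigma>\<^sup>2 L / 5\<close>, and \<open>L \<ge> log (e n / k) / 9\<close>.\<close>

section \<open>Monotone least squares\<close>

definition sqdist_on :: "'a set \<Rightarrow> ('a \<Rightarrow> real) \<Rightarrow> ('a \<Rightarrow> real) \<Rightarrow> real" where
  "sqdist_on I x y = (\<Sum>i\<in>I. (x i - y i)\<^sup>2)"

lemma closed_mono_on: "closed {\<theta>::'a::order \<Rightarrow> real. mono_on I \<theta>}"
proof -
  have "{\<theta>::'a \<Rightarrow> real. mono_on I \<theta>} = (\<Inter>i\<in>I. \<Inter>j\<in>{j\<in>I. i \<le> j}. {\<theta>. \<theta> i \<le> \<theta> j})"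
    by (auto simp: monotone_on_def)
  moreover have "closed {\<theta>::'a \<Rightarrow> real. \<theta> i \<le> \<theta> j}" for i j
    by (intro closed_Collect_le continuous_on_product_coordinates)
  ultimately show ?thesis by (simp add: closed_INT)
qed

lemma compact_PiE_interval: "compact (PiE UNIV (\<lambda>_::'a. {a..b::real}))"
proof -
  have "compactin (product_topology (\<lambda>_. euclidean) UNIV) (PiE UNIV (\<lambda>_::'a. {a..b::real}))"
    by (subst compactin_PiE) auto
  then show ?thesis by (simp add: euclidean_product_topology)
qed

lemma continuous_on_sqdist_on: "continuous_on S (sqdist_on I x)"
  unfolding sqdist_on_def
  by (intro continuous_intros continuous_on_subset[OF continuous_on_product_coordinates]) auto

lemma sqdist_on_clamp_le:
  assumes "\<forall>i\<in>I. a \<le> x i \<and> x i \<le> b"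
  shows "sqdist_on I x (\<lambda>i. max a (min b (\<eta> i))) \<le> sqdist_on I x \<eta>"
  unfolding sqdist_on_def
proof (rule sum_mono)
  fix i assume "i \<in> I"
  with assms have "\<bar>x i - max a (min b (\<eta> i))\<bar> \<le> \<bar>x i - \<eta> i\<bar>"
    by (auto simp: max_def min_def abs_if)
  then show "(x i - max a (min b (\<eta> i)))\<^sup>2 \<le> (x i - \<eta> i)\<^sup>2"
    by (metis abs_ge_zero power2_abs power_mono)
qed

text \<open>Clamping to an interval containing the data does not increase the loss, so a minimiser
  may be sought in a compact set.\<close>

lemma mono_lse_exists:
  fixes x :: "'a::order \<Rightarrow> real"
  assumes "\<forall>i\<in>I. a \<le> x i \<and> x i \<le> b" "a \<le> b"
  shows "\<exists>\<theta>. mono_on I \<theta> \<and> (\<forall>i. a \<le> \<theta> i \<and> \<theta> i \<le> b) \<and>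
           (\<forall>\<eta>. mono_on I \<eta> \<longrightarrow> sqdist_on I x \<theta> \<le> sqdist_on I x \<eta>)"
proof -
  let ?S = "PiE UNIV (\<lambda>_. {a..b}) \<inter> {\<theta>. mono_on I \<theta>}"
  have "compact ?S" using compact_PiE_interval closed_mono_on by blast
  moreover have "(\<lambda>_. a) \<in> ?S" using assms by (auto simp: monotone_on_def)
  ultimately obtain \<theta> where \<theta>: "\<theta> \<in> ?S" "\<forall>y\<in>?S. sqdist_on I x \<theta> \<le> sqdist_on I x y"
    using continuous_attains_inf[of ?S "sqdist_on I x"] continuous_on_sqdist_on by blast
  have "sqdist_on I x \<theta> \<le> sqdist_on I x \<eta>" if "mono_on I \<eta>" for \<eta>
  proof -
    have "mono_on I (\<lambda>i. max a (min b (\<eta> i)))"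
      using that unfolding monotone_on_def by (meson max.mono min.mono order_refl)
    then have "(\<lambda>i. max a (min b (\<eta> i))) \<in> ?S"
      using assms(2) by (auto simp: PiE_def Pi_def)
    then have "sqdist_on I x \<theta> \<le> sqdist_on I x (\<lambda>i. max a (min b (\<eta> i)))" using \<theta> by blast
    also have "\<dots> \<le> sqdist_on I x \<eta>" by (rule sqdist_on_clamp_le[OF assms(1)])
    finally show ?thesis .
  qed
  then show ?thesis using \<theta>(1) by (auto simp: PiE_def Pi_def)
qed

lemma sqdist_on_expand:
  "sqdist_on I x \<eta> = (\<Sum>i\<in>I. (x i)\<^sup>2) - 2 * (\<Sum>i\<in>I. x i * \<eta> i) + (\<Sum>i\<in>I. (\<eta> i)\<^sup>2)"
  unfolding sqdist_on_def
  by (simp add: power2_diff sum.distrib sum_subtractf sum_distrib_left algebra_simps)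

text \<open>The monotone vectors form a convex cone, so a least-squares fit \<open>\<theta>\<close> satisfies
  \<open>\<langle>x, \<theta>\<rangle> = \<parallel>\<theta>\<parallel>\<^sup>2\<close> (optimality along the ray through \<open>\<theta>\<close>) and hence
  \<open>\<parallel>\<theta>\<parallel>\<^sup>2 = sup\<^sub>u (2\<langle>x, u\<rangle> - \<parallel>u\<parallel>\<^sup>2)\<close> over monotone \<open>u\<close>.\<close>

lemma mono_lse_sqnorm_ge:
  assumes fin: "finite I" and \<theta>: "mono_on I \<theta>"
    and opt: "\<forall>\<eta>. mono_on I \<eta> \<longrightarrow> sqdist_on I x \<theta> \<le> sqdist_on I x \<eta>"
    and u: "mono_on I u"
  shows "2 * (\<Sum>i\<in>I. x i * u i) - (\<Sum>i\<in>I. (u i)\<^sup>2) \<le> (\<Sum>i\<in>I. (\<theta> i)\<^sup>2)"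
proof -
  define A where "A = (\<Sum>i\<in>I. (\<theta> i)\<^sup>2)"
  define B where "B = (\<Sum>i\<in>I. x i * \<theta> i)"
  define Z where "Z = (\<Sum>i\<in>I. (x i)\<^sup>2)"
  have scaled: "sqdist_on I x (\<lambda>i. t * \<theta> i) = Z - 2 * t * B + t\<^sup>2 * A" for t
    unfolding sqdist_on_expand Z_def B_def A_def
    by (simp add: sum_distrib_left power_mult_distrib algebra_simps)
  have A0: "A \<ge> 0" unfolding A_def by (intro sum_nonneg) auto
  have "B \<le> A"
  proof (cases "A = 0")
    case True
    then have "\<forall>i\<in>I. \<theta> i = 0" unfolding A_def using fin by (simp add: sum_nonneg_eq_0_iff)
    then show ?thesis unfolding B_def using True by simp
  next
    case False
    with A0 have A_pos: "A > 0" by simp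
    show "B \<le> A"
    proof (rule ccontr)
      assume "\<not> B \<le> A"
      then have t_pos: "B / A > 0" using A_pos by simp
      have "mono_on I (\<lambda>i. B / A * \<theta> i)"
        using t_pos by (intro mono_onI mult_left_mono mono_onD[OF \<theta>]) auto
      then have "sqdist_on I x (\<lambda>i. 1 * \<theta> i) \<le> sqdist_on I x (\<lambda>i. B / A * \<theta> i)" using opt by simp
      then have "Z - 2 * B + A \<le> Z - B * B / A"
        unfolding scaled using A_pos by (simp add: power2_eq_square field_simps)
      then have "(A - B)\<^sup>2 \<le> 0" using A_pos by (simp add: power2_eq_square field_simps)
      with \<open>\<not> B \<le> A\<close> show False by simp
    qed
  qed
  moreover have "sqdist_on I x \<theta> \<le> sqdist_on I x u" using opt u by blast
  ultimately show ?thesis unfolding sqdist_on_expand Z_def B_def A_def by linarith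
qed

text \<open>By strict convexity: the midpoint of two distinct fits would be strictly better.\<close>

lemma mono_lse_unique:
  assumes fin: "finite I"
    and \<theta>: "mono_on I \<theta>" "\<forall>\<eta>. mono_on I \<eta> \<longrightarrow> sqdist_on I x \<theta> \<le> sqdist_on I x \<eta>"
    and \<theta>': "mono_on I \<theta>'" "\<forall>\<eta>. mono_on I \<eta> \<longrightarrow> sqdist_on I x \<theta>' \<le> sqdist_on I x \<eta>"
    and i: "i \<in> I"
  shows "\<theta> i = \<theta>' i"
proof -
  let ?m = "\<lambda>i. (\<theta> i + \<theta>' i) / 2"
  have "mono_on I ?m"
    using \<theta>(1) \<theta>'(1) by (auto simp: monotone_on_def intro: add_mono divide_right_mono)
  then have m: "sqdist_on I x \<theta> \<le> sqdist_on I x ?m" using \<theta>(2) by blast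
  have eq: "sqdist_on I x \<theta> = sqdist_on I x \<theta>'" using \<theta> \<theta>' by (meson order_antisym)
  have "sqdist_on I x ?m = (\<Sum>i\<in>I. ((x i - \<theta> i)\<^sup>2 + (x i - \<theta>' i)\<^sup>2) / 2 - (\<theta> i - \<theta>' i)\<^sup>2 / 4)"
    unfolding sqdist_on_def by (intro sum.cong) (auto simp: power2_eq_square field_simps)
  also have "\<dots> = (sqdist_on I x \<theta> + sqdist_on I x \<theta>') / 2 - (\<Sum>i\<in>I. (\<theta> i - \<theta>' i)\<^sup>2) / 4"
    unfolding sqdist_on_def by (simp add: sum_subtractf sum_divide_distrib[symmetric] sum.distrib)
  finally have "(\<Sum>i\<in>I. (\<theta> i - \<theta>' i)\<^sup>2) \<le> 0" using m eq by simp
  then have "(\<Sum>i\<in>I. (\<theta> i - \<theta>' i)\<^sup>2) = 0" by (meson antisym sum_nonneg zero_le_power2)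
  with fin i show ?thesis by (simp add: sum_nonneg_eq_0_iff)
qed
lemma Theta_up_full: "Theta_up n n = {\<theta> \<in> extensional {1..n}. mono_on {1..n} \<theta>}"
proof (intro set_eqI iffI)
  fix \<theta> assume "\<theta> \<in> Theta_up n n"
  then obtain a \<mu> where \<theta>: "\<theta> \<in> extensional {1..n}" and a0: "a 0 = 0" and an: "a n = n"
    and \<mu>: "\<forall>j. 1 \<le> j \<and> j < n \<longrightarrow> \<mu> j \<le> \<mu> (j + 1)"
    and eq: "\<forall>j i. 1 \<le> j \<and> j \<le> n \<and> a (j - 1) < i \<and> i \<le> a j \<longrightarrow> \<theta> i = \<mu> j"
    unfolding Theta_up_def by blast
  define piece where "piece i = (LEAST j. i \<le> a j)" for i
  have piece: "\<theta> i = \<mu> (piece i) \<and> 1 \<le> piece i \<and> piece i \<le> n" if i: "i \<in> {1..n}" for i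
  proof -
    have ex: "i \<le> a n" using i an by simp
    have le: "piece i \<le> n" unfolding piece_def by (rule Least_le[of "\<lambda>j. i \<le> a j", OF ex])
    have ia: "i \<le> a (piece i)" unfolding piece_def by (rule LeastI[of "\<lambda>j. i \<le> a j", OF ex])
    have ge: "1 \<le> piece i" using ia a0 i by (cases "piece i") auto
    have "\<not> i \<le> a (piece i - 1)"
      using not_less_Least[of "piece i - 1" "\<lambda>j. i \<le> a j"] ge unfolding piece_def by simp
    then show ?thesis using eq le ge ia by auto
  qed
  have "mono_on {1..n} \<theta>"
  proof (rule mono_onI)
    fix i i' assume i: "i \<in> {1..n}" and i': "i' \<in> {1..n}" and "i \<le> i'"
    have "i' \<le> a (piece i')"
      unfolding piece_def by (rule LeastI[of "\<lambda>j. i' \<le> a j" n]) (use i' an in simp)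
    then have le: "piece i \<le> piece i'"
      unfolding piece_def using \<open>i \<le> i'\<close> by (intro Least_le) simp
    have "\<mu> j \<le> \<mu> (Suc j)" if "j \<in> {1..<n}" for j using that \<mu> by simp
    then have "\<mu> (piece i) \<le> \<mu> (piece i')"
    proof (rule lift_Suc_mono_le_ivl[OF _ le])
      show "{piece i..<piece i'} \<subseteq> {1..<n}" using piece[OF i] piece[OF i'] by auto
    qed
    then show "\<theta> i \<le> \<theta> i'" using piece[OF i] piece[OF i'] by simp
  qed
  with \<theta> show "\<theta> \<in> {\<theta> \<in> extensional {1..n}. mono_on {1..n} \<theta>}" by simp
next
  fix \<theta> :: "nat \<Rightarrow> real" assume \<theta>: "\<theta> \<in> {\<theta> \<in> extensional {1..n}. mono_on {1..n} \<theta>}"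
  have ij: "\<And>i j::nat. j - Suc 0 < i \<Longrightarrow> i \<le> j \<Longrightarrow> i = j" by arith
  show "\<theta> \<in> Theta_up n n"
    unfolding Theta_up_def using \<theta> ij
    by (auto simp: monotone_on_def intro!: exI[of _ "\<lambda>j. j"] exI[of _ \<theta>])
qed

lemma iso_est_eqI:
  assumes "q \<in> extensional {1..n}" "mono_on {1..n} q"
    and opt: "\<forall>\<eta>. mono_on {1..n} \<eta> \<longrightarrow> sqdist_on {1..n} x q \<le> sqdist_on {1..n} x \<eta>"
  shows "iso_est n x = q"
  unfolding iso_est_def
proof (rule the_equality)
  show "q \<in> Theta_up n n \<and> (\<forall>\<eta>\<in>Theta_up n n. sqdist_n n x q \<le> sqdist_n n x \<eta>)"
    using assms by (auto simp: Theta_up_full sqdist_n_def sqdist_on_def)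
next
  fix \<theta> assume \<theta>: "\<theta> \<in> Theta_up n n \<and> (\<forall>\<eta>\<in>Theta_up n n. sqdist_n n x \<theta> \<le> sqdist_n n x \<eta>)"
  have opt': "sqdist_on {1..n} x \<theta> \<le> sqdist_on {1..n} x \<eta>" if "mono_on {1..n} \<eta>" for \<eta>
  proof -
    have "restrict \<eta> {1..n} \<in> Theta_up n n"
      using that by (auto simp: Theta_up_full monotone_on_def)
    then have "sqdist_on {1..n} x \<theta> \<le> sqdist_on {1..n} x (restrict \<eta> {1..n})"
      using \<theta> by (auto simp: sqdist_n_def sqdist_on_def)
    also have "\<dots> = sqdist_on {1..n} x \<eta>" unfolding sqdist_on_def by (intro sum.cong) auto
    finally show ?thesis .
  qed
  show "\<theta> = q"
  proof (rule extensionalityI)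
    show "\<theta> \<in> extensional {1..n}" using \<theta> by (simp add: Theta_up_full)
    fix i assume "i \<in> {1..n}"
    then show "\<theta> i = q i"
      using mono_lse_unique[of "{1..n}" \<theta> x q] \<theta> opt' assms by (auto simp: Theta_up_full)
  qed (fact assms(1))
qed

text \<open>The fits of the residual on the level sets are bounded by \<open>M/2\<close>, so the gaps of height \<open>M\<close>
  between the levels make their combination monotone.\<close>

lemma mono_lse_separated_levels:
  fixes x ts :: "'a::order \<Rightarrow> real" and \<beta> :: "'a \<Rightarrow> nat"
  assumes fin: "finite I" and \<beta>: "mono_on I \<beta>"
    and close: "\<forall>i\<in>I. \<bar>x i - ts i\<bar> < M / 2"
    and ts: "\<forall>i\<in>I. ts i = M * real (\<beta> i)"
  shows "\<exists>q. mono_on I q \<and> (\<forall>\<eta>. mono_on I \<eta> \<longrightarrow> sqdist_on I x q \<le> sqdist_on I x \<eta>) \<and>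
     (\<forall>b. mono_on {i\<in>I. \<beta> i = b} (\<lambda>i. q i - ts i) \<and>
       (\<forall>\<eta>. mono_on {i\<in>I. \<beta> i = b} \<eta> \<longrightarrow>
          sqdist_on {i\<in>I. \<beta> i = b} (\<lambda>i. x i - ts i) (\<lambda>i. q i - ts i)
            \<le> sqdist_on {i\<in>I. \<beta> i = b} (\<lambda>i. x i - ts i) \<eta>))"
proof (cases "I = {}")
  case True
  then show ?thesis by (auto simp: monotone_on_def sqdist_on_def)
next
  case False
  define w where "w i = x i - ts i" for i
  define R where "R = Max ((\<lambda>i. \<bar>w i\<bar>) ` I)"
  define B where "B b = {i\<in>I. \<beta> i = b}" for b
  have R: "\<forall>i\<in>I. -R \<le> w i \<and> w i \<le> R"
  proof
    fix i assume "i \<in> I"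
    then have "\<bar>w i\<bar> \<le> R" unfolding R_def using fin by (intro Max_ge) auto
    then show "-R \<le> w i \<and> w i \<le> R" by linarith
  qed
  have RM: "R < M / 2"
  proof -
    have "R \<in> (\<lambda>i. \<bar>w i\<bar>) ` I" unfolding R_def using fin False by (intro Max_in) auto
    then show ?thesis using close by (auto simp: w_def)
  qed
  have R0: "0 \<le> R" using R False by fastforce
  have "\<forall>b. \<exists>p. mono_on (B b) p \<and> (\<forall>i. -R \<le> p i \<and> p i \<le> R) \<and>
           (\<forall>\<eta>. mono_on (B b) \<eta> \<longrightarrow> sqdist_on (B b) w p \<le> sqdist_on (B b) w \<eta>)"
    using mono_lse_exists[of "B _" "-R" w R] R R0 unfolding B_def by auto
  then obtain p where p: "\<And>b. mono_on (B b) (p b)" "\<And>b i. -R \<le> p b i \<and> p b i \<le> R"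
    "\<And>b \<eta>. mono_on (B b) \<eta> \<Longrightarrow> sqdist_on (B b) w (p b) \<le> sqdist_on (B b) w \<eta>"
    by metis
  define q where "q i = ts i + p (\<beta> i) i" for i
  have q_level: "q i - ts i = p b i" if "i \<in> B b" for i b
    using that unfolding q_def B_def by simp
  have "mono_on I q"
  proof (rule mono_onI)
    fix i i' assume i: "i \<in> I" and i': "i' \<in> I" and "i \<le> i'"
    then have "\<beta> i \<le> \<beta> i'" using \<beta> by (auto dest: mono_onD)
    show "q i \<le> q i'"
    proof (cases "\<beta> i = \<beta> i'")
      case True
      then show ?thesis
        using mono_onD[OF p(1)[of "\<beta> i"], of i i'] i i' \<open>i \<le> i'\<close> ts
        unfolding q_def B_def by auto
    next
      case False
      then have "M * (real (\<beta> i) + 1) \<le> M * real (\<beta> i')"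
        using \<open>\<beta> i \<le> \<beta> i'\<close> RM R0 by (intro mult_left_mono) auto
      then show ?thesis using ts i i' p(2)[of "\<beta> i" i] p(2)[of "\<beta> i'" i'] RM
        unfolding q_def by (simp add: algebra_simps)
    qed
  qed
  moreover have level_mono: "mono_on (B b) (\<lambda>i. q i - ts i)" for b
    using p(1)[of b] by (auto simp: monotone_on_def q_level[of _ b])
  moreover have level_opt: "sqdist_on (B b) w (\<lambda>i. q i - ts i) \<le> sqdist_on (B b) w \<eta>"
    if "mono_on (B b) \<eta>" for b \<eta>
  proof -
    have "sqdist_on (B b) w (\<lambda>i. q i - ts i) = sqdist_on (B b) w (p b)"
      unfolding sqdist_on_def by (intro sum.cong) (auto simp: q_level[of _ b])
    with p(3)[OF that] show ?thesis by simp
  qed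
  moreover have "sqdist_on I x q \<le> sqdist_on I x \<eta>" if "mono_on I \<eta>" for \<eta>
  proof -
    have split: "sqdist_on I x \<eta>' = (\<Sum>b\<in>\<beta> ` I. sqdist_on (B b) w (\<lambda>i. \<eta>' i - ts i))" for \<eta>'
      unfolding sqdist_on_def B_def w_def sum.image_gen[OF fin, of _ \<beta>]
      by (intro sum.cong) (auto simp: algebra_simps)
    have "mono_on (B b) (\<lambda>i. \<eta> i - ts i)" for b
      using that ts unfolding monotone_on_def B_def by auto
    then show ?thesis unfolding split using level_opt by (intro sum_mono) auto
  qed
  ultimately show ?thesis unfolding B_def w_def by blast
qed

section \<open>Standard Gaussian vectors\<close>

abbreviation std_normal_PiM :: "nat set \<Rightarrow> (nat \<Rightarrow> real) measure" where
  "std_normal_PiM I \<equiv> PiM I (\<lambda>_. density lborel std_normal_density)"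

lemma prob_space_std_normal: "prob_space (density lborel std_normal_density)"
  by (rule prob_space_normal_density) simp

interpretation std_normal: product_sigma_finite "\<lambda>_::nat. density lborel std_normal_density"
  unfolding product_sigma_finite_def using prob_space_std_normal prob_space_imp_sigma_finite by blast

lemma measurable_std_normal_PiM_coord: "i \<in> I \<Longrightarrow> (\<lambda>z. z i) \<in> borel_measurable (std_normal_PiM I)"
proof -
  assume i: "i \<in> I"
  have "measurable (std_normal_PiM I) (density lborel std_normal_density) = measurable (std_normal_PiM I) borel"
    by (rule measurable_cong_sets) auto
  then show ?thesis using measurable_component_singleton[OF i, of "\<lambda>_. density lborel std_normal_density"]
    by simp
qed

lemma integrable_std_normal_id: "integrable (density lborel std_normal_density) (\<lambda>t. t)"
  and integral_std_normal_id: "(\<integral>t. t \<partial>density lborel std_normal_density) = 0"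
  and integrable_std_normal_sq: "integrable (density lborel std_normal_density) (\<lambda>t. t\<^sup>2)"
  and integral_std_normal_sq: "(\<integral>t. t\<^sup>2 \<partial>density lborel std_normal_density) = 1"
proof -
  have nn: "AE x in lborel. 0 \<le> std_normal_density x" by (simp add: normal_density_nonneg)
  show "integrable (density lborel std_normal_density) (\<lambda>t. t)"
    using integrable_std_normal_moment[of 1] by (subst integrable_density) (auto simp: nn)
  show "integrable (density lborel std_normal_density) (\<lambda>t. t\<^sup>2)"
    using integrable_std_normal_moment[of 2] by (subst integrable_density) (auto simp: nn)
  show "(\<integral>t. t \<partial>density lborel std_normal_density) = 0"
    using integral_std_normal_moment_odd[of 0] by (subst integral_density) (auto simp: nn)
  show "(\<integral>t. t\<^sup>2 \<partial>density lborel std_normal_density) = 1"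
    using integral_std_normal_moment_even[of 1] by (subst integral_density) (auto simp: nn)
qed

lemma std_normal_PiM_covariance:
  assumes fin: "finite I" and i: "i \<in> I" and l: "l \<in> I"
  shows "integrable (std_normal_PiM I) (\<lambda>z. z i * z l)"
    and "(\<integral>z. z i * z l \<partial>std_normal_PiM I) = (if i = l then 1 else 0)"
proof -
  define f where "f = (\<lambda>j (t::real). (if j = i then t else 1) * (if j = l then t else 1))"
  have eq: "z i * z l = (\<Prod>j\<in>I. f j (z j))" for z
  proof -
    have "(\<Prod>j\<in>I. f j (z j)) = (\<Prod>j\<in>I. (if j = i then z j else 1)) * (\<Prod>j\<in>I. (if j = l then z j else 1))"
      unfolding f_def by (rule prod.distrib)
    also have "\<dots> = z i * z l" using fin i l by (simp only: prod.delta if_True)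
    finally show ?thesis by simp
  qed
  have fint: "integrable (density lborel std_normal_density) (f j)" for j
  proof -
    have "f j = (\<lambda>t. t\<^sup>2) \<or> f j = (\<lambda>t. t) \<or> f j = (\<lambda>t. 1)"
      unfolding f_def by (auto simp: power2_eq_square fun_eq_iff)
    moreover have "integrable (density lborel std_normal_density) (\<lambda>t. 1::real)"
      using prob_space_std_normal by (simp add: prob_space.finite_measure finite_measure.integrable_const)
    ultimately show ?thesis using integrable_std_normal_id integrable_std_normal_sq by metis
  qed
  show "integrable (std_normal_PiM I) (\<lambda>z. z i * z l)"
    unfolding eq by (intro std_normal.product_integrable_prod fin fint)
  have "(\<integral>z. z i * z l \<partial>std_normal_PiM I) = (\<Prod>j\<in>I. integral\<^sup>L (density lborel std_normal_density) (f j))"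
    unfolding eq by (intro std_normal.product_integral_prod fin fint)
  also have "\<dots> = (if i = l then 1 else 0)"
  proof (cases "i = l")
    case True
    have "integral\<^sup>L (density lborel std_normal_density) (f j) = 1" for j
    proof (cases "j = i")
      case True
      then have "f j = (\<lambda>t. t\<^sup>2)" unfolding f_def using \<open>i = l\<close> by (auto simp: power2_eq_square fun_eq_iff)
      then show ?thesis using integral_std_normal_sq by simp
    next
      case False
      then have "f j = (\<lambda>t. 1)" unfolding f_def using \<open>i = l\<close> by (auto simp: fun_eq_iff)
      then show ?thesis using prob_space.prob_space[OF prob_space_std_normal] by simp
    qed
    then show ?thesis using True by simp
  next
    case False
    have "f i = (\<lambda>t. t)" unfolding f_def using False by (auto simp: fun_eq_iff)
    then have "integral\<^sup>L (density lborel std_normal_density) (f i) = 0" using integral_std_normal_id by simp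
    then have "(\<Prod>j\<in>I. integral\<^sup>L (density lborel std_normal_density) (f j)) = 0"
      using fin i by (metis (no_types, lifting) prod_zero)
    then show ?thesis using False by simp
  qed
  finally show "(\<integral>z. z i * z l \<partial>std_normal_PiM I) = (if i = l then 1 else 0)" .
qed

lemma std_normal_PiM_sum_sq:
  assumes fin: "finite I" and A: "A \<subseteq> I"
  shows "integrable (std_normal_PiM I) (\<lambda>z. (\<Sum>i\<in>A. z i)\<^sup>2)"
    and "(\<integral>z. (\<Sum>i\<in>A. z i)\<^sup>2 \<partial>std_normal_PiM I) = real (card A)"
proof -
  have finA: "finite A" using fin A by (rule finite_subset[rotated])
  have eq: "(\<Sum>i\<in>A. z i)\<^sup>2 = (\<Sum>i\<in>A. \<Sum>l\<in>A. z i * z l)" for z :: "nat \<Rightarrow> real"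
    by (simp add: power2_eq_square sum_product)
  have intij: "integrable (std_normal_PiM I) (\<lambda>z. z i * z l)" if "i \<in> A" "l \<in> A" for i l
    using std_normal_PiM_covariance(1)[OF fin] that A by auto
  have inti: "integrable (std_normal_PiM I) (\<lambda>z. \<Sum>l\<in>A. z i * z l)" if "i \<in> A" for i
    using intij[OF that] by (rule Bochner_Integration.integrable_sum)
  show "integrable (std_normal_PiM I) (\<lambda>z. (\<Sum>i\<in>A. z i)\<^sup>2)"
    unfolding eq using inti by (rule Bochner_Integration.integrable_sum)
  have "(\<integral>z. (\<Sum>i\<in>A. z i)\<^sup>2 \<partial>std_normal_PiM I) = (\<Sum>i\<in>A. (\<integral>z. (\<Sum>l\<in>A. z i * z l) \<partial>std_normal_PiM I))"
    unfolding eq using inti by (rule Bochner_Integration.integral_sum)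
  also have "\<dots> = (\<Sum>i\<in>A. \<Sum>l\<in>A. (\<integral>z. z i * z l \<partial>std_normal_PiM I))"
    using intij by (intro sum.cong refl Bochner_Integration.integral_sum)
  also have "\<dots> = (\<Sum>i\<in>A. \<Sum>l\<in>A. (if i = l then 1 else 0))"
    using A by (intro sum.cong refl std_normal_PiM_covariance(2)[OF fin]) auto
  also have "\<dots> = real (card A)" using finA by simp
  finally show "(\<integral>z. (\<Sum>i\<in>A. z i)\<^sup>2 \<partial>std_normal_PiM I) = real (card A)" .
qed

lemma distr_std_normal_uminus: "distr (density lborel std_normal_density) (density lborel std_normal_density) uminus
   = density lborel std_normal_density"
proof -
  let ?M = "density lborel std_normal_density"
  interpret p: prob_space ?M by (rule prob_space_std_normal)
  have d: "distributed ?M lborel (\<lambda>x. x) std_normal_density"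
    unfolding distributed_def by (auto simp: distr_id2)
  have "distributed ?M lborel (\<lambda>x. 0 + (-1) * x) (normal_density (0 + (-1) * 0) (\<bar>-1\<bar> * 1))"
    by (rule p.normal_density_affine[OF d]) auto
  then have "distr ?M lborel (\<lambda>x. - x) = ?M" by (simp add: distributed_def)
  moreover have "distr ?M ?M uminus = distr ?M lborel (\<lambda>x. - x)"
    by (intro distr_cong) auto
  ultimately show ?thesis by simp
qed

lemma distr_std_normal_PiM_uminus:
  assumes fin: "finite I"
  shows "distr (std_normal_PiM I) (std_normal_PiM I) (compose I uminus) = std_normal_PiM I"
proof -
  have "distr (std_normal_PiM I) (std_normal_PiM I) (compose I uminus) =
     PiM I (\<lambda>i. distr (density lborel std_normal_density) (density lborel std_normal_density) uminus)"
    by (rule distr_PiM_finite_prob_space'[OF fin prob_space_std_normal prob_space_std_normal]) auto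
  then show ?thesis by (simp add: distr_std_normal_uminus)
qed

lemma std_normal_PiM_neg_part_sum_sq:
  assumes fin: "finite I" and A: "A \<subseteq> I"
  shows "integrable (std_normal_PiM I) (\<lambda>z. (max 0 (- (\<Sum>i\<in>A. z i)))\<^sup>2)"
    and "(\<integral>z. (max 0 (- (\<Sum>i\<in>A. z i)))\<^sup>2 \<partial>std_normal_PiM I) = real (card A) / 2"
proof -
  have finA: "finite A" using fin A by (rule finite_subset[rotated])
  have ms: "(\<lambda>z. (\<Sum>i\<in>A. z i)) \<in> borel_measurable (std_normal_PiM I)"
    using A by (intro borel_measurable_sum measurable_std_normal_PiM_coord) auto
  have mT: "compose I uminus \<in> measurable (std_normal_PiM I) (std_normal_PiM I)"
    unfolding compose_def
    by (intro measurable_restrict) (auto intro!: measurable_compose[OF measurable_component_singleton])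
  have bnd: "(max 0 (-s))\<^sup>2 \<le> s\<^sup>2" "(max 0 s)\<^sup>2 \<le> s\<^sup>2" for s :: real
    by (auto simp: max_def)
  show int1: "integrable (std_normal_PiM I) (\<lambda>z. (max 0 (- (\<Sum>i\<in>A. z i)))\<^sup>2)"
    by (rule Bochner_Integration.integrable_bound[OF std_normal_PiM_sum_sq(1)[OF fin A]])
       (use ms in \<open>auto intro!: bnd\<close>)
  have int2: "integrable (std_normal_PiM I) (\<lambda>z. (max 0 (\<Sum>i\<in>A. z i))\<^sup>2)"
    by (rule Bochner_Integration.integrable_bound[OF std_normal_PiM_sum_sq(1)[OF fin A]])
       (use ms in \<open>auto intro!: bnd\<close>)
  have sym: "(\<integral>z. (max 0 (\<Sum>i\<in>A. z i))\<^sup>2 \<partial>std_normal_PiM I) = (\<integral>z. (max 0 (- (\<Sum>i\<in>A. z i)))\<^sup>2 \<partial>std_normal_PiM I)"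
  proof -
    have "(\<integral>z. (max 0 (- (\<Sum>i\<in>A. z i)))\<^sup>2 \<partial>std_normal_PiM I) =
          (\<integral>z. (max 0 (- (\<Sum>i\<in>A. z i)))\<^sup>2 \<partial>distr (std_normal_PiM I) (std_normal_PiM I) (compose I uminus))"
      by (simp add: distr_std_normal_PiM_uminus[OF fin])
    also have "\<dots> = (\<integral>z. (max 0 (- (\<Sum>i\<in>A. compose I uminus z i)))\<^sup>2 \<partial>std_normal_PiM I)"
      by (rule integral_distr[OF mT]) (use ms in auto)
    also have "\<dots> = (\<integral>z. (max 0 (\<Sum>i\<in>A. z i))\<^sup>2 \<partial>std_normal_PiM I)"
    proof (intro Bochner_Integration.integral_cong refl)
      fix z :: "nat \<Rightarrow> real"
      have "(\<Sum>i\<in>A. compose I uminus z i) = (\<Sum>i\<in>A. - z i)"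
        using A by (intro sum.cong) (auto simp: compose_def)
      then show "(max 0 (- (\<Sum>i\<in>A. compose I uminus z i)))\<^sup>2 = (max 0 (\<Sum>i\<in>A. z i))\<^sup>2"
        by (simp add: sum_negf)
    qed
    finally show ?thesis by simp
  qed
  have split: "(\<Sum>i\<in>A. z i)\<^sup>2 = (max 0 (\<Sum>i\<in>A. z i))\<^sup>2 + (max 0 (- (\<Sum>i\<in>A. z i)))\<^sup>2" for z :: "nat \<Rightarrow> real"
    by (auto simp: max_def power2_eq_square)
  have "real (card A) = (\<integral>z. (max 0 (\<Sum>i\<in>A. z i))\<^sup>2 + (max 0 (- (\<Sum>i\<in>A. z i)))\<^sup>2 \<partial>std_normal_PiM I)"
    using std_normal_PiM_sum_sq(2)[OF fin A] by (simp only: split)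
  also have "\<dots> = 2 * (\<integral>z. (max 0 (- (\<Sum>i\<in>A. z i)))\<^sup>2 \<partial>std_normal_PiM I)"
    using int1 int2 sym by simp
  finally show "(\<integral>z. (max 0 (- (\<Sum>i\<in>A. z i)))\<^sup>2 \<partial>std_normal_PiM I) = real (card A) / 2" by simp
qed

lemma distr_PiM_finite_prob_space_indexed:
  assumes fin: "finite I"
  assumes "product_prob_space M"
  assumes "product_prob_space M'"
  assumes [measurable]: "\<And>i. i \<in> I \<Longrightarrow> f i \<in> measurable (M i) (M' i)"
  shows   "distr (PiM I M) (PiM I M') (\<lambda>x. \<lambda>i\<in>I. f i (x i)) = PiM I (\<lambda>i. distr (M i) (M' i) (f i))"
proof -
  interpret M: product_prob_space M by fact
  interpret M': product_prob_space M' by fact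
  define N where "N = (\<lambda>i. if i \<in> I then distr (M i) (M' i) (f i) else M' i)"
  have [intro]: "prob_space (N i)" for i
    by (auto simp: N_def intro!: M.M.prob_space_distr M'.prob_space)
  interpret N: product_prob_space N
    by (intro product_prob_spaceI) (auto simp: N_def M'.prob_space intro: M.M.prob_space_distr)
  have mf: "(\<lambda>x. \<lambda>i\<in>I. f i (x i)) \<in> Pi\<^sub>M I M \<rightarrow>\<^sub>M Pi\<^sub>M I M'"
    by (intro measurable_restrict) (auto intro!: measurable_compose[OF measurable_component_singleton])
  have "distr (PiM I M) (PiM I M') (\<lambda>x. \<lambda>i\<in>I. f i (x i)) = PiM I N"
  proof (rule N.PiM_eqI)
    have N_events_eq: "sets (Pi\<^sub>M I N) = sets (Pi\<^sub>M I M')"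
      unfolding N_def by (intro sets_PiM_cong) auto
    also have "\<dots> = sets (distr (Pi\<^sub>M I M) (Pi\<^sub>M I M') (\<lambda>x. \<lambda>i\<in>I. f i (x i)))"
      by simp
    finally show "sets (distr (Pi\<^sub>M I M) (Pi\<^sub>M I M') (\<lambda>x. \<lambda>i\<in>I. f i (x i))) = sets (Pi\<^sub>M I N)"  ..
    fix A assume A: "\<And>i. i \<in> I \<Longrightarrow> A i \<in> N.M.events i"
    have "emeasure (distr (Pi\<^sub>M I M) (Pi\<^sub>M I M') (\<lambda>x. \<lambda>i\<in>I. f i (x i))) (Pi\<^sub>E I A) =
          emeasure (Pi\<^sub>M I M) ((\<lambda>x. \<lambda>i\<in>I. f i (x i)) -` Pi\<^sub>E I A \<inter> space (Pi\<^sub>M I M))"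
    proof (intro emeasure_distr)
      show "(\<lambda>x. \<lambda>i\<in>I. f i (x i)) \<in> Pi\<^sub>M I M \<rightarrow>\<^sub>M Pi\<^sub>M I M'" by (rule mf)
      show "Pi\<^sub>E I A \<in> sets (Pi\<^sub>M I M')"
        unfolding N_events_eq [symmetric] by (intro sets_PiM_I_finite fin A)
    qed
    also have "(\<lambda>x. \<lambda>i\<in>I. f i (x i)) -` Pi\<^sub>E I A \<inter> space (Pi\<^sub>M I M) = Pi\<^sub>E I (\<lambda>i. f i -` A i \<inter> space (M i))"
      using A by (auto simp: space_PiM PiE_def Pi_def extensional_def N_def)
    also have "emeasure (Pi\<^sub>M I M) (Pi\<^sub>E I (\<lambda>i. f i -` A i \<inter> space (M i))) =
          (\<Prod>i\<in>I. emeasure (M i) (f i -` A i \<inter> space (M i)))"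
      using A by (intro M.emeasure_PiM fin) (auto simp: N_def)
    also have "\<dots> = (\<Prod>i\<in>I. emeasure (distr (M i) (M' i) (f i)) (A i))"
      using A by (intro prod.cong emeasure_distr [symmetric]) (auto simp: N_def)
    also have "\<dots> = (\<Prod>i\<in>I. emeasure (N i) (A i))"
      unfolding N_def by (intro prod.cong) (auto simp: N_def)
    finally show "emeasure (distr (Pi\<^sub>M I M) (Pi\<^sub>M I M') (\<lambda>x. \<lambda>i\<in>I. f i (x i))) (Pi\<^sub>E I A) = \<dots>" .
  qed (rule fin)
  also have "PiM I N = PiM I (\<lambda>i. distr (M i) (M' i) (f i))"
    by (intro PiM_cong) (auto simp: N_def)
  finally show ?thesis .
qed

lemma distr_std_normal_affine:
  assumes s: "\<sigma> > 0"
  shows "distr (density lborel std_normal_density) (density lborel (normal_density \<mu> \<sigma>)) (\<lambda>t. \<mu> + \<sigma> * t)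
   = density lborel (normal_density \<mu> \<sigma>)"
proof -
  let ?M = "density lborel std_normal_density"
  interpret p: prob_space ?M by (rule prob_space_std_normal)
  have d: "distributed ?M lborel (\<lambda>x. x) std_normal_density"
    unfolding distributed_def by (auto simp: distr_id2)
  have "distributed ?M lborel (\<lambda>x. \<mu> + \<sigma> * x) (normal_density (\<mu> + \<sigma> * 0) (\<bar>\<sigma>\<bar> * 1))"
    by (rule p.normal_density_affine[OF d]) (use s in auto)
  then have "distr ?M lborel (\<lambda>x. \<mu> + \<sigma> * x) = density lborel (normal_density \<mu> \<sigma>)"
    using s by (simp add: distributed_def)
  moreover have "distr ?M (density lborel (normal_density \<mu> \<sigma>)) (\<lambda>x. \<mu> + \<sigma> * x) = distr ?M lborel (\<lambda>x. \<mu> + \<sigma> * x)"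
    by (intro distr_cong) auto
  ultimately show ?thesis by simp
qed

lemma gauss_n_eq_distr_std_normal:
  assumes s: "\<sigma> > 0"
  shows "gauss_n n \<theta> \<sigma> = distr (std_normal_PiM {1..n}) (gauss_n n \<theta> \<sigma>) (\<lambda>z. \<lambda>i\<in>{1..n}. \<theta> i + \<sigma> * z i)"
proof -
  have pp: "product_prob_space (\<lambda>i. density lborel (normal_density (\<theta> i) \<sigma>))"
    by (intro product_prob_spaceI prob_space_normal_density s)
  have pp0: "product_prob_space (\<lambda>_::nat. density lborel std_normal_density)"
    by (intro product_prob_spaceI prob_space_std_normal)
  have "distr (std_normal_PiM {1..n}) (gauss_n n \<theta> \<sigma>) (\<lambda>z. \<lambda>i\<in>{1..n}. \<theta> i + \<sigma> * z i)
     = PiM {1..n} (\<lambda>i. distr (density lborel std_normal_density) (density lborel (normal_density (\<theta> i) \<sigma>)) (\<lambda>t. \<theta> i + \<sigma> * t))"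
    unfolding gauss_n_def by (rule distr_PiM_finite_prob_space_indexed[OF _ pp0 pp]) auto
  also have "\<dots> = gauss_n n \<theta> \<sigma>"
    unfolding gauss_n_def using s by (simp add: distr_std_normal_affine)
  finally show ?thesis by simp
qed

lemma measurable_gauss_n_coord: "i \<in> {1..n} \<Longrightarrow> (\<lambda>x. x i) \<in> borel_measurable (gauss_n n \<theta> \<sigma>)"
proof -
  assume i: "i \<in> {1..n}"
  have "measurable (gauss_n n \<theta> \<sigma>) (density lborel (normal_density (\<theta> i) \<sigma>)) = measurable (gauss_n n \<theta> \<sigma>) borel"
    by (rule measurable_cong_sets) auto
  then show ?thesis using measurable_component_singleton[OF i, of "\<lambda>i. density lborel (normal_density (\<theta> i) \<sigma>)"]
    unfolding gauss_n_def by simp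
qed

section \<open>The running-maximum test vector\<close>

lemma running_max_step:
  fixes a x :: real
  shows "x\<^sup>2 - 3/2 * (max 0 (-x))\<^sup>2 - 3 * (max 0 a)\<^sup>2 \<le> 2 * max a x * x - (max a x)\<^sup>2"
proof (cases "a \<le> x")
  case True
  have "0 \<le> (max 0 (-x))\<^sup>2" "0 \<le> (max 0 a)\<^sup>2" by simp_all
  moreover have "2 * max a x * x - (max a x)\<^sup>2 = x\<^sup>2" using True by (simp add: power2_eq_square)
  ultimately show ?thesis by linarith
next
  case False
  define p where "p = max 0 a"
  define q where "q = max 0 (-x)"
  have "0 \<le> p" "0 \<le> q" "0 \<le> a - x" "a - x \<le> p + q" unfolding p_def q_def using False by auto
  then have "(a - x)\<^sup>2 \<le> (p + q)\<^sup>2" by (intro power_mono) auto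
  also have "\<dots> \<le> 3 * p\<^sup>2 + 3/2 * q\<^sup>2"
    using zero_le_power2[of "p - q/2"] by (simp add: power2_eq_square algebra_simps)
  finally show ?thesis
    using False unfolding p_def q_def by (simp add: power2_eq_square algebra_simps)
qed

lemma ordered_pieces_disjoint:
  fixes P :: "nat \<Rightarrow> 'a::order set"
  assumes ord: "\<forall>j\<in>J. \<forall>j'\<in>J. j < j' \<longrightarrow> (\<forall>i\<in>P j. \<forall>i'\<in>P j'. i < i')"
    and "j \<in> J" "j' \<in> J" "j \<noteq> j'"
  shows "P j \<inter> P j' = {}"
  using assms by (metis disjoint_iff less_irrefl linorder_neqE_nat)

lemma sum_piecewise_const_quadratic:
  assumes "finite J" "\<forall>j\<in>J. finite (P j)"
    and disj: "\<forall>j\<in>J. \<forall>j'\<in>J. j \<noteq> j' \<longrightarrow> P j \<inter> P j' = {}"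
    and u: "\<forall>j\<in>J. \<forall>i\<in>P j. u i = c j"
  shows "2 * (\<Sum>i\<in>(\<Union>j\<in>J. P j). w i * u i) - (\<Sum>i\<in>(\<Union>j\<in>J. P j). (u i)\<^sup>2)
           = (\<Sum>j\<in>J. 2 * c j * (\<Sum>i\<in>P j. w i) - real (card (P j)) * (c j)\<^sup>2)"
proof -
  have "2 * (\<Sum>i\<in>(\<Union>j\<in>J. P j). w i * u i) - (\<Sum>i\<in>(\<Union>j\<in>J. P j). (u i)\<^sup>2)
      = (\<Sum>i\<in>(\<Union>j\<in>J. P j). 2 * w i * u i - (u i)\<^sup>2)"
    by (simp add: sum_subtractf sum_distrib_left mult.assoc)
  also have "\<dots> = (\<Sum>j\<in>J. \<Sum>i\<in>P j. 2 * w i * u i - (u i)\<^sup>2)"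
    using assms by (intro sum.UNION_disjoint) auto
  also have "\<dots> = (\<Sum>j\<in>J. \<Sum>i\<in>P j. 2 * c j * w i - (c j)\<^sup>2)"
    using u by (intro sum.cong refl) (auto simp: mult.commute)
  finally show ?thesis by (simp add: sum_subtractf sum_distrib_left)
qed

definition piece_sum :: "(nat \<Rightarrow> 'a set) \<Rightarrow> ('a \<Rightarrow> real) \<Rightarrow> nat \<Rightarrow> real" where
  "piece_sum P w j = (\<Sum>i\<in>P j. w i)"

definition piece_size :: "(nat \<Rightarrow> 'a set) \<Rightarrow> nat \<Rightarrow> real" where
  "piece_size P j = real (card (P j))"

text \<open>A lower bound for \<open>2\<langle>w, u\<rangle> - \<parallel>u\<parallel>\<^sup>2\<close> when \<open>u\<close> is the running maximum of the piece averages
  of \<open>w\<close>; the subtracted terms pay for the pieces where the running maximum exceeds the average.\<close>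

definition running_max_bound :: "(nat \<Rightarrow> 'a set) \<Rightarrow> nat \<Rightarrow> ('a \<Rightarrow> real) \<Rightarrow> real" where
  "running_max_bound P L w =
     (\<Sum>j\<in>{1..L}. (piece_sum P w j)\<^sup>2 / piece_size P j) -
     (\<Sum>j\<in>{2..L}. 3/2 * (max 0 (- piece_sum P w j))\<^sup>2 / piece_size P j +
        3 * piece_size P j * (\<Sum>l\<in>{1..j-1}. (piece_sum P w l / piece_size P l)\<^sup>2))"

lemma running_max_bound_le:
  fixes P :: "nat \<Rightarrow> 'a::order set"
  assumes L: "L \<ge> 1"
    and fin: "\<forall>j\<in>{1..L}. finite (P j) \<and> P j \<noteq> {}"
    and ord: "\<forall>j\<in>{1..L}. \<forall>j'\<in>{1..L}. j < j' \<longrightarrow> (\<forall>i\<in>P j. \<forall>i'\<in>P j'. i < i')"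
  shows "\<exists>u. mono_on (\<Union>j\<in>{1..L}. P j) u \<and>
     running_max_bound P L w \<le> 2 * (\<Sum>i\<in>(\<Union>j\<in>{1..L}. P j). w i * u i) - (\<Sum>i\<in>(\<Union>j\<in>{1..L}. P j). (u i)\<^sup>2)"
proof -
  define x where "x j = piece_sum P w j / piece_size P j" for j
  define c where "c j = Max (x ` {1..j})" for j
  define u where "u i = (\<Sum>j\<in>{1..L}. if i \<in> P j then c j else 0)" for i
  have disj: "\<forall>j\<in>{1..L}. \<forall>j'\<in>{1..L}. j \<noteq> j' \<longrightarrow> P j \<inter> P j' = {}"
    using ordered_pieces_disjoint[OF ord] by blast
  have u_piece: "\<forall>j\<in>{1..L}. \<forall>i\<in>P j. u i = c j"
  proof (intro ballI)
    fix j i assume j: "j \<in> {1..L}" and i: "i \<in> P j"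
    have "i \<notin> P j'" if "j' \<in> {1..L}" "j' \<noteq> j" for j' using disj that j i by blast
    then have "u i = (\<Sum>j'\<in>{1..L}. if j' = j then c j' else 0)"
      unfolding u_def using i by (intro sum.cong refl) auto
    then show "u i = c j" using j by simp
  qed
  have size_pos: "piece_size P j > 0" if "j \<in> {1..L}" for j
    using fin that unfolding piece_size_def by (auto simp: card_gt_0_iff)
  have u_mono: "mono_on (\<Union>j\<in>{1..L}. P j) u"
  proof (rule mono_onI)
    fix i i' assume "i \<in> (\<Union>j\<in>{1..L}. P j)" "i' \<in> (\<Union>j\<in>{1..L}. P j)" "i \<le> i'"
    then obtain j j' where j: "j \<in> {1..L}" "i \<in> P j" and j': "j' \<in> {1..L}" "i' \<in> P j'" by blast
    with ord \<open>i \<le> i'\<close> have "j \<le> j'" by (meson leD not_le_imp_less)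
    then have "c j \<le> c j'" unfolding c_def using j by (intro Max_mono) auto
    then show "u i \<le> u i'" using u_piece j j' by simp
  qed
  define T where "T j = 2 * c j * piece_sum P w j - piece_size P j * (c j)\<^sup>2" for j
  have gain: "2 * (\<Sum>i\<in>(\<Union>j\<in>{1..L}. P j). w i * u i) - (\<Sum>i\<in>(\<Union>j\<in>{1..L}. P j). (u i)\<^sup>2)
      = (\<Sum>j\<in>{1..L}. T j)"
    unfolding T_def piece_sum_def piece_size_def
    using fin disj u_piece by (intro sum_piecewise_const_quadratic) auto
  have T_first: "T 1 = (piece_sum P w 1)\<^sup>2 / piece_size P 1"
    using size_pos[of 1] L unfolding T_def c_def x_def by (simp add: power2_eq_square field_simps)
  have T_ge: "(piece_sum P w j)\<^sup>2 / piece_size P j - (3/2 * (max 0 (- piece_sum P w j))\<^sup>2 / piece_size P j +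
         3 * piece_size P j * (\<Sum>l\<in>{1..j-1}. (piece_sum P w l / piece_size P l)\<^sup>2)) \<le> T j"
    if j: "j \<in> {2..L}" for j
  proof -
    let ?s = "piece_size P j"
    have s: "?s > 0" using size_pos j by simp
    have "c (j - 1) \<in> x ` {1..j-1}" unfolding c_def using j by (intro Max_in) auto
    then obtain l0 where l0: "l0 \<in> {1..j-1}" "c (j - 1) = x l0" by blast
    have "{1..j} = insert j {1..j-1}" using j by auto
    then have "x ` {1..j} = insert (x j) (x ` {1..j-1})" by simp
    moreover have "x ` {1..j-1} \<noteq> {}" using j by auto
    ultimately have cj: "c j = max (c (j - 1)) (x j)"
      unfolding c_def by (simp add: max.commute)
    let ?a = "c (j - 1)"
    have "(max 0 ?a)\<^sup>2 \<le> (\<Sum>l\<in>{1..j-1}. (x l)\<^sup>2)"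
      using l0 member_le_sum[of l0 "{1..j-1}" "\<lambda>l. (x l)\<^sup>2"] sum_nonneg[of "{1..j-1}" "\<lambda>l. (x l)\<^sup>2"]
      by (auto simp: max_def)
    then have past: "?s * (max 0 ?a)\<^sup>2 \<le> ?s * (\<Sum>l\<in>{1..j-1}. (piece_sum P w l / piece_size P l)\<^sup>2)"
      using s unfolding x_def by (intro mult_left_mono) auto
    have Sx: "piece_sum P w j = ?s * x j" unfolding x_def using s by simp
    have "?s * (2 * max ?a (x j) * x j - (max ?a (x j))\<^sup>2) = T j"
      unfolding T_def cj Sx by (simp add: power2_eq_square algebra_simps)
    then have step: "?s * (x j)\<^sup>2 - 3/2 * (?s * (max 0 (- x j))\<^sup>2) - 3 * (?s * (max 0 ?a)\<^sup>2) \<le> T j"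
      using mult_left_mono[OF running_max_step[of "x j" ?a], of ?s] s by (simp add: algebra_simps)
    have "max 0 (- piece_sum P w j) = ?s * max 0 (- x j)"
      unfolding x_def using s by (auto simp: max_def field_simps)
    then have "?s * (max 0 (- x j))\<^sup>2 = (max 0 (- piece_sum P w j))\<^sup>2 / ?s"
      using s by (simp add: power2_eq_square)
    moreover have "?s * (x j)\<^sup>2 = (piece_sum P w j)\<^sup>2 / ?s"
      unfolding Sx using s by (simp add: power2_eq_square field_simps)
    ultimately show ?thesis using step past by (simp add: algebra_simps)
  qed
  have "(\<Sum>j\<in>{2..L}. (piece_sum P w j)\<^sup>2 / piece_size P j) - (\<Sum>j\<in>{2..L}. 3/2 * (max 0 (- piece_sum P w j))\<^sup>2 / piece_size P j +
         3 * piece_size P j * (\<Sum>l\<in>{1..j-1}. (piece_sum P w l / piece_size P l)\<^sup>2)) \<le> (\<Sum>j\<in>{2..L}. T j)"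
    unfolding sum_subtractf[symmetric] by (intro sum_mono T_ge)
  moreover have "{1..L} = insert 1 {2..L}" using L by auto
  ultimately have "running_max_bound P L w \<le> (\<Sum>j\<in>{1..L}. T j)"
    unfolding running_max_bound_def using T_first by simp
  with u_mono gain show ?thesis by auto
qed

lemma running_max_bound_integral:
  assumes fin: "finite I" and P: "\<forall>j\<in>{1..L}. P j \<subseteq> I \<and> P j \<noteq> {}"
  shows "integrable (std_normal_PiM I) (running_max_bound P L)"
    and "(\<integral>z. running_max_bound P L z \<partial>std_normal_PiM I) =
           real L - (\<Sum>j\<in>{2..L}. 3/4 + 3 * (\<Sum>l\<in>{1..j-1}. piece_size P j / piece_size P l))"
proof -
  let ?M = "std_normal_PiM I" and ?S = "\<lambda>z. piece_sum P z" and ?s = "piece_size P"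
  have sq: "integrable ?M (\<lambda>z. (?S z j)\<^sup>2)" "(\<integral>z. (?S z j)\<^sup>2 \<partial>?M) = ?s j"
    if "j \<in> {1..L}" for j
    using std_normal_PiM_sum_sq[OF fin, of "P j"] P that unfolding piece_sum_def piece_size_def by auto
  have neg: "integrable ?M (\<lambda>z. (max 0 (- ?S z j))\<^sup>2)" "(\<integral>z. (max 0 (- ?S z j))\<^sup>2 \<partial>?M) = ?s j / 2"
    if "j \<in> {1..L}" for j
    using std_normal_PiM_neg_part_sum_sq[OF fin, of "P j"] P that
    unfolding piece_sum_def piece_size_def by auto
  have s_pos: "?s j > 0" if "j \<in> {1..L}" for j
    using P finite_subset[OF _ fin] that unfolding piece_size_def by (auto simp: card_gt_0_iff)
  have canon: "running_max_bound P L z = (\<Sum>j\<in>{1..L}. (1 / ?s j) * (?S z j)\<^sup>2) -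
      (\<Sum>j\<in>{2..L}. (3/2 / ?s j) * (max 0 (- ?S z j))\<^sup>2 +
         (\<Sum>l\<in>{1..j-1}. (3 * ?s j / (?s l)\<^sup>2) * (?S z l)\<^sup>2))" for z
    unfolding running_max_bound_def by (simp add: sum_distrib_left power_divide algebra_simps)
  have inner: "integrable ?M (\<lambda>z. \<Sum>l\<in>{1..j-1}. (3 * ?s j / (?s l)\<^sup>2) * (?S z l)\<^sup>2)"
    "(\<integral>z. (\<Sum>l\<in>{1..j-1}. (3 * ?s j / (?s l)\<^sup>2) * (?S z l)\<^sup>2) \<partial>?M) =
       3 * (\<Sum>l\<in>{1..j-1}. ?s j / ?s l)"
    if "j \<in> {2..L}" for j
  proof -
    have l: "l \<in> {1..L}" if "l \<in> {1..j-1}" for l using that \<open>j \<in> {2..L}\<close> by auto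
    show "integrable ?M (\<lambda>z. \<Sum>l\<in>{1..j-1}. (3 * ?s j / (?s l)\<^sup>2) * (?S z l)\<^sup>2)"
      using sq(1)[OF l] by (intro Bochner_Integration.integrable_sum integrable_mult_right) auto
    have "(\<integral>z. (\<Sum>l\<in>{1..j-1}. (3 * ?s j / (?s l)\<^sup>2) * (?S z l)\<^sup>2) \<partial>?M) =
        (\<Sum>l\<in>{1..j-1}. (3 * ?s j / (?s l)\<^sup>2) * ?s l)"
      using sq[OF l] by (subst Bochner_Integration.integral_sum) (auto intro!: sum.cong)
    also have "\<dots> = 3 * (\<Sum>l\<in>{1..j-1}. ?s j / ?s l)"
      unfolding sum_distrib_left using s_pos[OF l] by (intro sum.cong refl) (simp add: power2_eq_square)
    finally show "(\<integral>z. (\<Sum>l\<in>{1..j-1}. (3 * ?s j / (?s l)\<^sup>2) * (?S z l)\<^sup>2) \<partial>?M) =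
       3 * (\<Sum>l\<in>{1..j-1}. ?s j / ?s l)" .
  qed
  have first: "integrable ?M (\<lambda>z. \<Sum>j\<in>{1..L}. (1 / ?s j) * (?S z j)\<^sup>2)"
    "(\<integral>z. (\<Sum>j\<in>{1..L}. (1 / ?s j) * (?S z j)\<^sup>2) \<partial>?M) = real L"
  proof -
    show "integrable ?M (\<lambda>z. \<Sum>j\<in>{1..L}. (1 / ?s j) * (?S z j)\<^sup>2)"
      using sq(1) by (intro Bochner_Integration.integrable_sum integrable_mult_right) auto
    have "(\<integral>z. (\<Sum>j\<in>{1..L}. (1 / ?s j) * (?S z j)\<^sup>2) \<partial>?M) = (\<Sum>j\<in>{1..L}. (1 / ?s j) * ?s j)"
      using sq by (subst Bochner_Integration.integral_sum) (auto intro!: sum.cong)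
    also have "\<dots> = (\<Sum>j\<in>{1..L}. 1)"
      by (intro sum.cong refl) (use s_pos in \<open>force simp: field_simps\<close>)
    also have "\<dots> = real L" by simp
    finally show "(\<integral>z. (\<Sum>j\<in>{1..L}. (1 / ?s j) * (?S z j)\<^sup>2) \<partial>?M) = real L" .
  qed
  have penalty_term: "integrable ?M (\<lambda>z. (3/2 / ?s j) * (max 0 (- ?S z j))\<^sup>2 +
         (\<Sum>l\<in>{1..j-1}. (3 * ?s j / (?s l)\<^sup>2) * (?S z l)\<^sup>2))"
    "(\<integral>z. (3/2 / ?s j) * (max 0 (- ?S z j))\<^sup>2 +
         (\<Sum>l\<in>{1..j-1}. (3 * ?s j / (?s l)\<^sup>2) * (?S z l)\<^sup>2) \<partial>?M) =
       3/4 + 3 * (\<Sum>l\<in>{1..j-1}. ?s j / ?s l)"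
    if j: "j \<in> {2..L}" for j
  proof -
    have j1: "j \<in> {1..L}" using j by auto
    show "integrable ?M (\<lambda>z. (3/2 / ?s j) * (max 0 (- ?S z j))\<^sup>2 +
         (\<Sum>l\<in>{1..j-1}. (3 * ?s j / (?s l)\<^sup>2) * (?S z l)\<^sup>2))"
      using neg(1)[OF j1] inner(1)[OF j] by (intro Bochner_Integration.integrable_add integrable_mult_right)
    have "(\<integral>z. (3/2 / ?s j) * (max 0 (- ?S z j))\<^sup>2 +
         (\<Sum>l\<in>{1..j-1}. (3 * ?s j / (?s l)\<^sup>2) * (?S z l)\<^sup>2) \<partial>?M) =
        (\<integral>z. (3/2 / ?s j) * (max 0 (- ?S z j))\<^sup>2 \<partial>?M) +
        (\<integral>z. (\<Sum>l\<in>{1..j-1}. (3 * ?s j / (?s l)\<^sup>2) * (?S z l)\<^sup>2) \<partial>?M)"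
      using neg(1)[OF j1] inner(1)[OF j] by (intro Bochner_Integration.integral_add integrable_mult_right)
    also have "\<dots> = (3/2 / ?s j) * (?s j / 2) + 3 * (\<Sum>l\<in>{1..j-1}. ?s j / ?s l)"
      by (simp only: integral_mult_right_zero neg(2)[OF j1] inner(2)[OF j])
    also have "(3/2 / ?s j) * (?s j / 2) = 3/4" using s_pos[OF j1] by simp
    finally show "(\<integral>z. (3/2 / ?s j) * (max 0 (- ?S z j))\<^sup>2 +
         (\<Sum>l\<in>{1..j-1}. (3 * ?s j / (?s l)\<^sup>2) * (?S z l)\<^sup>2) \<partial>?M) =
       3/4 + 3 * (\<Sum>l\<in>{1..j-1}. ?s j / ?s l)" .
  qed
  have penalty: "integrable ?M (\<lambda>z. \<Sum>j\<in>{2..L}. (3/2 / ?s j) * (max 0 (- ?S z j))\<^sup>2 +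
         (\<Sum>l\<in>{1..j-1}. (3 * ?s j / (?s l)\<^sup>2) * (?S z l)\<^sup>2))"
    "(\<integral>z. (\<Sum>j\<in>{2..L}. (3/2 / ?s j) * (max 0 (- ?S z j))\<^sup>2 +
         (\<Sum>l\<in>{1..j-1}. (3 * ?s j / (?s l)\<^sup>2) * (?S z l)\<^sup>2)) \<partial>?M) =
       (\<Sum>j\<in>{2..L}. 3/4 + 3 * (\<Sum>l\<in>{1..j-1}. ?s j / ?s l))"
    using penalty_term by (auto intro!: Bochner_Integration.integrable_sum sum.cong
        simp: Bochner_Integration.integral_sum)
  show "integrable ?M (running_max_bound P L)"
    unfolding canon[abs_def] using first(1) penalty(1) by (rule Bochner_Integration.integrable_diff)
  show "(\<integral>z. running_max_bound P L z \<partial>?M) =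
           real L - (\<Sum>j\<in>{2..L}. 3/4 + 3 * (\<Sum>l\<in>{1..j-1}. ?s j / ?s l))"
    unfolding canon using first penalty by simp
qed

section \<open>Blocks and pieces\<close>

definition block_len :: "nat \<Rightarrow> nat \<Rightarrow> nat" where
  "block_len n k = n div k"

definition block_start :: "nat \<Rightarrow> nat \<Rightarrow> nat \<Rightarrow> nat" where
  "block_start n k b = (b - 1) * block_len n k"

definition block_end :: "nat \<Rightarrow> nat \<Rightarrow> nat \<Rightarrow> nat" where
  "block_end n k b = (if b = k then n else b * block_len n k)"

definition block_of :: "nat \<Rightarrow> nat \<Rightarrow> nat \<Rightarrow> nat" where
  "block_of n k i = min k ((i - 1) div block_len n k + 1)"

text \<open>Each block is cut into \<open>L = num_pieces n k\<close> consecutive pieces; for \<open>j \<ge> 2\<close> the \<open>j\<close>-th piece has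
  length \<open>64 ^ (L - j)\<close>, and the first piece takes the rest of the block, which is at least
  \<open>64 ^ (L - 1)\<close> since \<open>128 ^ (L - 1) \<le> block_len n k\<close>. The intersection with \<open>{1..n}\<close> in \<open>piece\<close>
  only matters for block indices outside \<open>{1..k}\<close>.\<close>

definition num_pieces :: "nat \<Rightarrow> nat \<Rightarrow> nat" where
  "num_pieces n k = nat \<lfloor>log 128 (real (block_len n k))\<rfloor> + 1"

definition tail_len :: "nat \<Rightarrow> nat \<Rightarrow> nat \<Rightarrow> nat" where
  "tail_len n k j = (\<Sum>d<num_pieces n k - j. 64 ^ d)"

definition piece_end :: "nat \<Rightarrow> nat \<Rightarrow> nat \<Rightarrow> nat \<Rightarrow> nat" where
  "piece_end n k b j = (if j = 0 then block_start n k b else block_end n k b - tail_len n k j)"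

definition piece :: "nat \<Rightarrow> nat \<Rightarrow> nat \<Rightarrow> nat \<Rightarrow> nat set" where
  "piece n k b j = {piece_end n k b (j - 1)<..piece_end n k b j} \<inter> {1..n}"

lemma sum_pow64_le_pow128: "(\<Sum>d<q+1. (64::nat) ^ d) \<le> 128 ^ q"
proof (induction q)
  case (Suc q)
  have "(64::nat) ^ q \<le> 128 ^ q" by (intro power_mono) auto
  then have "(64::nat) ^ (q + 1) \<le> 127 * 128 ^ q" by simp
  with Suc show ?case by simp
qed simp

lemma UN_greaterThanAtMost_chain:
  fixes E :: "nat \<Rightarrow> nat"
  assumes "\<And>j. 1 \<le> j \<Longrightarrow> j \<le> J \<Longrightarrow> E (j - 1) \<le> E j"
  shows "(\<Union>j\<in>{1..J}. {E (j - 1)<..E j}) = {E 0<..E J}"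
  using assms
proof (induction J)
  case (Suc J)
  have "E 0 \<le> E J"
  proof (rule lift_Suc_mono_le_ivl[where f = E and N = "{0..<J}"])
    show "E m \<le> E (Suc m)" if "m \<in> {0..<J}" for m using Suc.prems[of "Suc m"] that by simp
  qed auto
  moreover have "{1..Suc J} = insert (Suc J) {1..J}" by auto
  ultimately show ?case using Suc Suc.prems[of "Suc J"] by auto
qed simp

lemma tail_len_antimono: "j \<le> j' \<Longrightarrow> tail_len n k j' \<le> tail_len n k j"
  unfolding tail_len_def by (intro sum_mono2) auto

lemma tail_len_step:
  "1 \<le> j \<Longrightarrow> j \<le> num_pieces n k \<Longrightarrow> tail_len n k (j - 1) = tail_len n k j + 64 ^ (num_pieces n k - j)"
proof -
  assume "1 \<le> j" "j \<le> num_pieces n k"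
  then have "num_pieces n k - (j - 1) = Suc (num_pieces n k - j)" by simp
  then show ?thesis unfolding tail_len_def by simp
qed

lemma sum_pow_inverse64_le: "(\<Sum>l\<in>{1..j-1}. (1/64::real) ^ (j - l)) \<le> 1/63"
proof (induction j)
  case (Suc j)
  show ?case
  proof (cases "j = 0")
    case False
    then have "{1..Suc j - 1} = insert j {1..j-1}" by auto
    then have "(\<Sum>l\<in>{1..Suc j - 1}. (1/64::real) ^ (Suc j - l))
        = 1/64 + (\<Sum>l\<in>{1..j-1}. (1/64) ^ (Suc j - l))" using False by simp
    also have "(\<Sum>l\<in>{1..j-1}. (1/64::real) ^ (Suc j - l)) = 1/64 * (\<Sum>l\<in>{1..j-1}. (1/64) ^ (j - l))"
      unfolding sum_distrib_left by (intro sum.cong refl) (auto simp: Suc_diff_le)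
    finally show ?thesis using Suc.IH by simp
  qed simp
qed simp

context
  fixes n k :: nat
  assumes k1: "1 \<le> k" and kn: "k \<le> n"
begin

lemma block_len_pos: "1 \<le> block_len n k"
  using div_le_mono[OF kn, of k] k1 unfolding block_len_def by simp

lemma pow128_num_pieces_le: "128 ^ (num_pieces n k - 1) \<le> block_len n k"
  and ln_block_len_less: "ln (real (block_len n k)) < real (num_pieces n k) * ln 128"
proof -
  let ?q = "nat \<lfloor>log 128 (real (block_len n k))\<rfloor>"
  have m1: "real (block_len n k) \<ge> 1" using block_len_pos by simp
  then have q: "real ?q = of_int \<lfloor>log 128 (real (block_len n k))\<rfloor>" by simp
  have "real (128 ^ ?q) = 128 powr real ?q" by (simp add: powr_realpow)
  also have "\<dots> \<le> 128 powr log 128 (real (block_len n k))"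
    unfolding q by (intro powr_mono) auto
  also have "\<dots> = real (block_len n k)" using m1 by simp
  finally show "128 ^ (num_pieces n k - 1) \<le> block_len n k"
    unfolding num_pieces_def by simp
  have "ln (real (block_len n k)) = log 128 (real (block_len n k)) * ln 128" by (simp add: log_def)
  also have "\<dots> < (real ?q + 1) * ln 128" unfolding q by (intro mult_strict_right_mono) (linarith, simp)
  finally show "ln (real (block_len n k)) < real (num_pieces n k) * ln 128"
    unfolding num_pieces_def by (simp add: add.commute)
qed

lemma tail_len_first: "tail_len n k 1 + 64 ^ (num_pieces n k - 1) \<le> block_len n k"
proof -
  have "tail_len n k 1 + 64 ^ (num_pieces n k - 1) = (\<Sum>d<(num_pieces n k - 1) + 1. (64::nat) ^ d)"
    unfolding tail_len_def num_pieces_def by simp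
  also have "\<dots> \<le> 128 ^ (num_pieces n k - 1)" by (rule sum_pow64_le_pow128)
  also have "\<dots> \<le> block_len n k" by (rule pow128_num_pieces_le)
  finally show ?thesis .
qed

lemma block_start_end:
  assumes "b \<in> {1..k}"
  shows "block_start n k b + block_len n k \<le> block_end n k b" "block_end n k b \<le> n"
proof -
  have "b * block_len n k \<le> k * block_len n k" using assms by (intro mult_right_mono) auto
  also have "\<dots> \<le> n" unfolding block_len_def by (simp add: mult.commute)
  finally have "b * block_len n k \<le> n" .
  moreover have "block_start n k b + block_len n k = b * block_len n k"
    unfolding block_start_def using assms by (cases b) auto
  ultimately show "block_start n k b + block_len n k \<le> block_end n k b" "block_end n k b \<le> n"
    unfolding block_end_def using assms by auto
qed

context
  fixes b assumes b: "b \<in> {1..k}"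
begin

lemma piece_end_first_gap: "64 ^ (num_pieces n k - 1) \<le> piece_end n k b 1 - piece_end n k b 0"
  using block_start_end[OF b] tail_len_first unfolding piece_end_def by simp

lemma piece_end_gap:
  assumes "j \<in> {2..num_pieces n k}"
  shows "piece_end n k b j - piece_end n k b (j - 1) = 64 ^ (num_pieces n k - j)"
proof -
  have "tail_len n k (j - 1) \<le> tail_len n k 1" using assms by (intro tail_len_antimono) auto
  then have "tail_len n k (j - 1) \<le> block_end n k b"
    using tail_len_first block_start_end[OF b] by linarith
  moreover have "tail_len n k (j - 1) = tail_len n k j + 64 ^ (num_pieces n k - j)"
    using assms by (intro tail_len_step) auto
  moreover have "j - 1 \<noteq> 0" "j \<noteq> 0" using assms by auto
  ultimately show ?thesis unfolding piece_end_def by simp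
qed

lemma piece_end_less:
  assumes "j \<in> {1..num_pieces n k}"
  shows "piece_end n k b (j - 1) < piece_end n k b j"
proof (cases "j = 1")
  case True
  have "0 < piece_end n k b 1 - piece_end n k b 0"
    using zero_less_power[of 64] piece_end_first_gap by (rule less_le_trans) simp
  with True show ?thesis by simp
next
  case False
  with assms have "0 < piece_end n k b j - piece_end n k b (j - 1)"
    using piece_end_gap[of j] by simp
  then show ?thesis by simp
qed

lemma piece_eq: "piece n k b j = {piece_end n k b (j - 1)<..piece_end n k b j}"
proof -
  have "piece_end n k b j \<le> n" using block_start_end[OF b] unfolding piece_end_def by auto
  then show ?thesis unfolding piece_def by auto
qed

lemma pieces_union: "(\<Union>j\<in>{1..num_pieces n k}. piece n k b j) = {block_start n k b<..block_end n k b}"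
proof -
  have "piece_end n k b (j - 1) \<le> piece_end n k b j" if "1 \<le> j" "j \<le> num_pieces n k" for j
    using piece_end_less[of j] that by simp
  then show ?thesis
    unfolding piece_eq by (subst UN_greaterThanAtMost_chain) (auto simp: piece_end_def num_pieces_def tail_len_def)
qed

lemma pieces_nonempty: "j \<in> {1..num_pieces n k} \<Longrightarrow> finite (piece n k b j) \<and> piece n k b j \<noteq> {}"
  using piece_end_less[of j] by (auto simp: piece_eq)

lemma pieces_ordered:
  "\<forall>j\<in>{1..num_pieces n k}. \<forall>j'\<in>{1..num_pieces n k}. j < j' \<longrightarrow>
     (\<forall>i\<in>piece n k b j. \<forall>i'\<in>piece n k b j'. i < i')"
proof (intro ballI impI)
  fix j j' i i' assume j: "j \<in> {1..num_pieces n k}" and j': "j' \<in> {1..num_pieces n k}" and "j < j'"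
    and i: "i \<in> piece n k b j" and i': "i' \<in> piece n k b j'"
  have "piece_end n k b j \<le> piece_end n k b (j' - 1)"
  proof (rule lift_Suc_mono_le_ivl[where f = "piece_end n k b" and N = "{1..<num_pieces n k}"])
    show "piece_end n k b m \<le> piece_end n k b (Suc m)" if "m \<in> {1..<num_pieces n k}" for m
      using piece_end_less[of "Suc m"] that by simp
  qed (use \<open>j < j'\<close> j j' in auto)
  then show "i < i'" using i i' by (auto simp: piece_eq)
qed

lemma piece_size_eq: "j \<in> {2..num_pieces n k} \<Longrightarrow> piece_size (piece n k b) j = 64 ^ (num_pieces n k - j)"
  using piece_end_gap[of j] by (simp add: piece_size_def piece_eq)

lemma piece_size_ge:
  assumes "j \<in> {1..num_pieces n k}"
  shows "64 ^ (num_pieces n k - j) \<le> piece_size (piece n k b) j"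
proof (cases "j = 1")
  case True
  then show ?thesis using piece_end_first_gap by (simp add: piece_size_def piece_eq of_nat_le_iff[symmetric])
next
  case False
  then show ?thesis using piece_size_eq[of j] assms by simp
qed

lemma piece_size_ratio:
  assumes "1 \<le> l" "l < j" "j \<le> num_pieces n k"
  shows "piece_size (piece n k b) j / piece_size (piece n k b) l \<le> (1/64) ^ (j - l)"
proof -
  let ?L = "num_pieces n k"
  have pos: "(0::real) < 64 ^ (?L - l)" by simp
  have ge: "64 ^ (?L - l) \<le> piece_size (piece n k b) l" using piece_size_ge[of l] assms by simp
  then have "0 < piece_size (piece n k b) l" using pos by linarith
  then have "0 < piece_size (piece n k b) l * 64 ^ (?L - l)" using pos by simp
  then have "piece_size (piece n k b) j / piece_size (piece n k b) l \<le> 64 ^ (?L - j) / 64 ^ (?L - l)"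
    using piece_size_eq[of j] assms by (auto intro!: divide_left_mono[OF ge])
  also have "(64::real) ^ (?L - l) = 64 ^ (?L - j) * 64 ^ (j - l)"
    using assms by (simp add: power_add[symmetric])
  also have "64 ^ (?L - j) / (64 ^ (?L - j) * 64 ^ (j - l)) = (1/64::real) ^ (j - l)"
    by (simp add: power_one_over)
  finally show ?thesis .
qed

lemma running_max_bound_pieces:
  shows "integrable (std_normal_PiM {1..n}) (running_max_bound (piece n k b) (num_pieces n k))"
    and "real (num_pieces n k) / 5 \<le>
           (\<integral>z. running_max_bound (piece n k b) (num_pieces n k) z \<partial>std_normal_PiM {1..n})"
proof -
  let ?P = "piece n k b" and ?L = "num_pieces n k"
  have P: "\<forall>j\<in>{1..?L}. ?P j \<subseteq> {1..n} \<and> ?P j \<noteq> {}"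
    using pieces_nonempty by (auto simp: piece_def)
  show "integrable (std_normal_PiM {1..n}) (running_max_bound ?P ?L)"
    by (rule running_max_bound_integral(1)[OF _ P]) simp
  have "3 * (\<Sum>l\<in>{1..j-1}. piece_size ?P j / piece_size ?P l) \<le> 3 * (1/63)" if "j \<in> {2..?L}" for j
  proof -
    have "(\<Sum>l\<in>{1..j-1}. piece_size ?P j / piece_size ?P l) \<le> (\<Sum>l\<in>{1..j-1}. (1/64) ^ (j - l))"
      using that by (intro sum_mono piece_size_ratio) auto
    then show ?thesis using sum_pow_inverse64_le[of j] by simp
  qed
  then have "(\<Sum>j\<in>{2..?L}. 3/4 + 3 * (\<Sum>l\<in>{1..j-1}. piece_size ?P j / piece_size ?P l))
      \<le> (\<Sum>j\<in>{2..?L}. 3/4 + 3/63)"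
    by (intro sum_mono) auto
  also have "\<dots> = (real ?L - 1) * (3/4 + 3/63)" unfolding num_pieces_def by simp
  finally have "(\<Sum>j\<in>{2..?L}. 3/4 + 3 * (\<Sum>l\<in>{1..j-1}. piece_size ?P j / piece_size ?P l))
      \<le> (real ?L - 1) * (3/4 + 3/63)" .
  moreover have "1 \<le> real ?L" unfolding num_pieces_def by simp
  moreover have "(\<integral>z. running_max_bound ?P ?L z \<partial>std_normal_PiM {1..n}) =
      real ?L - (\<Sum>j\<in>{2..?L}. 3/4 + 3 * (\<Sum>l\<in>{1..j-1}. piece_size ?P j / piece_size ?P l))"
    by (rule running_max_bound_integral(2)[OF _ P]) simp
  ultimately show "real ?L / 5 \<le> (\<integral>z. running_max_bound ?P ?L z \<partial>std_normal_PiM {1..n})"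
    by (simp add: algebra_simps)
qed

lemma block_of_eq: "{i\<in>{1..n}. block_of n k i = b} = {block_start n k b<..block_end n k b}"
proof -
  have m: "0 < block_len n k" using block_len_pos by simp
  note hl = block_start_end[OF b]
  have lob: "block_start n k b = (b - 1) * block_len n k" unfolding block_start_def ..
  show ?thesis
  proof (intro set_eqI iffI)
    fix i assume "i \<in> {i\<in>{1..n}. block_of n k i = b}"
    then have i: "1 \<le> i" "i \<le> n" and bi: "min k ((i - 1) div block_len n k + 1) = b" unfolding block_of_def by auto
    have "b - 1 \<le> (i - 1) div block_len n k" using bi by linarith
    then have "(b - 1) * block_len n k \<le> i - 1" using less_eq_div_iff_mult_less_eq[OF m] by simp
    then have lo_i: "block_start n k b < i" unfolding lob using i by linarith
    have "i \<le> block_end n k b"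
    proof (cases "b = k")
      case True then show ?thesis unfolding block_end_def using i by simp
    next
      case False
      then have "(i - 1) div block_len n k + 1 = b" using bi by linarith
      then have "(i - 1) div block_len n k < b" by simp
      then have "i - 1 < b * block_len n k" using div_less_iff_less_mult[OF m] by simp
      then show ?thesis unfolding block_end_def using False by simp
    qed
    with lo_i show "i \<in> {block_start n k b<..block_end n k b}" by simp
  next
    fix i assume "i \<in> {block_start n k b<..block_end n k b}"
    then have i: "block_start n k b < i" "i \<le> block_end n k b" by auto
    have i1: "1 \<le> i" "i \<le> n" using i hl by auto
    have "(b - 1) * block_len n k \<le> i - 1" using i(1) unfolding lob by linarith
    then have d1: "b - 1 \<le> (i - 1) div block_len n k" using less_eq_div_iff_mult_less_eq[OF m] by simp
    have "block_of n k i = b"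
    proof (cases "b = k")
      case True
      then show ?thesis unfolding block_of_def using d1 b by auto
    next
      case False
      then have "i - 1 < b * block_len n k" using i(2) i1 unfolding block_end_def by simp
      then have "(i - 1) div block_len n k < b" using div_less_iff_less_mult[OF m] by simp
      then show ?thesis unfolding block_of_def using d1 b False by auto
    qed
    with i1 show "i \<in> {i\<in>{1..n}. block_of n k i = b}" by simp
  qed
qed

end

lemma block_of_range: "i \<in> {1..n} \<Longrightarrow> block_of n k i \<in> {1..k}"
  unfolding block_of_def using k1 by auto

end

lemma block_of_mono: "mono (block_of n k)"
  unfolding block_of_def by (intro monoI min.mono order.refl add_right_mono div_le_mono diff_le_mono)

section \<open>The lower bound\<close>

definition staircase :: "nat \<Rightarrow> nat \<Rightarrow> real \<Rightarrow> nat \<Rightarrow> real" where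
  "staircase n k N = restrict (\<lambda>i. N * real (block_of n k i)) {1..n}"

definition blocks_running_max_bound :: "nat \<Rightarrow> nat \<Rightarrow> (nat \<Rightarrow> real) \<Rightarrow> real" where
  "blocks_running_max_bound n k z = (\<Sum>b\<in>{1..k}. running_max_bound (piece n k b) (num_pieces n k) z)"

lemma blocks_running_max_bound_cong:
  "(\<forall>i\<in>{1..n}. z i = z' i) \<Longrightarrow> blocks_running_max_bound n k z = blocks_running_max_bound n k z'"
  unfolding blocks_running_max_bound_def running_max_bound_def piece_sum_def piece_def by simp

lemma borel_measurable_blocks_running_max_bound:
  assumes "\<forall>i\<in>{1..n}. (\<lambda>x. g x i) \<in> borel_measurable M"
  shows "(\<lambda>x. blocks_running_max_bound n k (g x)) \<in> borel_measurable M"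
proof -
  have [measurable]: "(\<lambda>x. piece_sum (piece n k b) (g x) j) \<in> borel_measurable M" for b j
    unfolding piece_sum_def piece_def using assms by (intro borel_measurable_sum) auto
  show ?thesis unfolding blocks_running_max_bound_def running_max_bound_def by measurable
qed

context
  fixes n k :: nat
  assumes k1: "1 \<le> k" and kn: "k \<le> n"
begin

lemma staircase_in_Theta_up: "N \<ge> 0 \<Longrightarrow> staircase n k N \<in> Theta_up n k"
proof -
  assume N: "N \<ge> 0"
  define a where "a j = (if j = 0 then 0 else block_end n k j)" for j
  define \<mu> where "\<mu> j = N * real j" for j
  have a_start: "a (j - 1) = block_start n k j" if "j \<in> {1..k}" for j
  proof (cases "j = 1")
    case False
    then have "j - 1 \<noteq> k" "j - 1 \<noteq> 0" using that by auto
    then show ?thesis unfolding a_def block_end_def block_start_def by simp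
  qed (simp add: a_def block_start_def)
  have a_end: "a j = block_end n k j" if "j \<in> {1..k}" for j using that unfolding a_def by simp
  show ?thesis unfolding Theta_up_def
  proof (intro CollectI conjI exI[of _ a] exI[of _ \<mu>])
    show "staircase n k N \<in> extensional {1..n}" unfolding staircase_def by simp
    show "a 0 = 0" "a k = n" unfolding a_def block_end_def using k1 by simp_all
    show "\<forall>j. 1 \<le> j \<and> j \<le> k \<longrightarrow> a (j - 1) \<le> a j"
    proof (intro allI impI)
      fix j assume "1 \<le> j \<and> j \<le> k"
      then show "a (j - 1) \<le> a j"
        using a_start[of j] a_end[of j] block_start_end[OF k1 kn, of j] by simp
    qed
    show "\<forall>j. 1 \<le> j \<and> j < k \<longrightarrow> \<mu> j \<le> \<mu> (j + 1)"
      unfolding \<mu>_def using N by (auto intro: mult_left_mono)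
    show "\<forall>j i. 1 \<le> j \<and> j \<le> k \<and> a (j - 1) < i \<and> i \<le> a j \<longrightarrow> staircase n k N i = \<mu> j"
    proof (intro allI impI)
      fix j i assume h: "1 \<le> j \<and> j \<le> k \<and> a (j - 1) < i \<and> i \<le> a j"
      then have j: "j \<in> {1..k}" by simp
      then have "i \<in> {i\<in>{1..n}. block_of n k i = j}"
        using h a_start[OF j] a_end[OF j] block_of_eq[OF k1 kn j] by simp
      then show "staircase n k N i = \<mu> j" unfolding staircase_def \<mu>_def by simp
    qed
  qed
qed

lemma iso_est_sqdist_ge:
  assumes \<sigma>: "\<sigma> > 0" and small: "\<forall>i\<in>{1..n}. \<bar>x i - staircase n k N i\<bar> < N / 2"
  shows "\<sigma>\<^sup>2 * blocks_running_max_bound n k (\<lambda>i. (x i - staircase n k N i) / \<sigma>)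
           \<le> sqdist_n n (iso_est n x) (staircase n k N)"
proof -
  let ?I = "{1..n}" and ?ts = "staircase n k N" and ?\<beta> = "block_of n k"
  let ?B = "\<lambda>b. {i\<in>?I. ?\<beta> i = b}"
  define w where "w i = (x i - ?ts i) / \<sigma>" for i
  have "mono_on ?I ?\<beta>" using block_of_mono by (rule monotone_on_subset) simp
  moreover have "\<forall>i\<in>?I. ?ts i = N * real (?\<beta> i)" unfolding staircase_def by simp
  ultimately obtain q where q: "mono_on ?I q" "\<forall>\<eta>. mono_on ?I \<eta> \<longrightarrow> sqdist_on ?I x q \<le> sqdist_on ?I x \<eta>"
    and q_level: "\<And>b. mono_on (?B b) (\<lambda>i. q i - ?ts i)"
      "\<And>b \<eta>. mono_on (?B b) \<eta> \<Longrightarrow> sqdist_on (?B b) (\<lambda>i. x i - ?ts i) (\<lambda>i. q i - ?ts i)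
                  \<le> sqdist_on (?B b) (\<lambda>i. x i - ?ts i) \<eta>"
    using mono_lse_separated_levels[OF _ _ small] by blast
  have "iso_est n x = restrict q ?I"
  proof (rule iso_est_eqI)
    have "sqdist_on ?I x (restrict q ?I) = sqdist_on ?I x q" unfolding sqdist_on_def by simp
    then show "\<forall>\<eta>. mono_on ?I \<eta> \<longrightarrow> sqdist_on ?I x (restrict q ?I) \<le> sqdist_on ?I x \<eta>" using q(2) by simp
  qed (use q(1) in \<open>auto simp: monotone_on_def\<close>)
  then have "sqdist_n n (iso_est n x) ?ts = (\<Sum>i\<in>?I. (q i - ?ts i)\<^sup>2)"
    unfolding sqdist_n_def by simp
  also have "\<dots> = (\<Sum>b\<in>{1..k}. \<Sum>i\<in>?B b. (q i - ?ts i)\<^sup>2)"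
    using block_of_range[OF k1 kn] by (intro sum.group[symmetric]) auto
  finally have split: "sqdist_n n (iso_est n x) ?ts = (\<Sum>b\<in>{1..k}. \<Sum>i\<in>?B b. (q i - ?ts i)\<^sup>2)" .
  have block: "\<sigma>\<^sup>2 * running_max_bound (piece n k b) (num_pieces n k) w \<le> (\<Sum>i\<in>?B b. (q i - ?ts i)\<^sup>2)"
    if b: "b \<in> {1..k}" for b
  proof -
    have B: "?B b = (\<Union>j\<in>{1..num_pieces n k}. piece n k b j)"
      using block_of_eq[OF k1 kn b] pieces_union[OF k1 kn b] by simp
    have "1 \<le> num_pieces n k" unfolding num_pieces_def by simp
    moreover have "\<forall>j\<in>{1..num_pieces n k}. finite (piece n k b j) \<and> piece n k b j \<noteq> {}"
      using pieces_nonempty[OF k1 kn b] by blast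
    ultimately obtain u where u: "mono_on (?B b) u"
      and bound: "running_max_bound (piece n k b) (num_pieces n k) w
                    \<le> 2 * (\<Sum>i\<in>?B b. w i * u i) - (\<Sum>i\<in>?B b. (u i)\<^sup>2)"
      using running_max_bound_le[OF _ _ pieces_ordered[OF k1 kn b], of w] unfolding B by blast
    have "(\<Sum>i\<in>?B b. (x i - ?ts i) * (\<sigma> * u i)) = \<sigma>\<^sup>2 * (\<Sum>i\<in>?B b. w i * u i)"
      unfolding sum_distrib_left w_def using \<sigma> by (intro sum.cong refl) (simp add: power2_eq_square field_simps)
    moreover have "(\<Sum>i\<in>?B b. (\<sigma> * u i)\<^sup>2) = \<sigma>\<^sup>2 * (\<Sum>i\<in>?B b. (u i)\<^sup>2)"
      by (simp add: sum_distrib_left power_mult_distrib)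
    ultimately have "\<sigma>\<^sup>2 * running_max_bound (piece n k b) (num_pieces n k) w
        \<le> 2 * (\<Sum>i\<in>?B b. (x i - ?ts i) * (\<sigma> * u i)) - (\<Sum>i\<in>?B b. (\<sigma> * u i)\<^sup>2)"
      using mult_left_mono[OF bound, of "\<sigma>\<^sup>2"] by (simp add: algebra_simps)
    also have "\<dots> \<le> (\<Sum>i\<in>?B b. (q i - ?ts i)\<^sup>2)"
    proof (rule mono_lse_sqnorm_ge[OF _ q_level(1)])
      show "mono_on (?B b) (\<lambda>i. \<sigma> * u i)"
        using u \<sigma> by (auto simp: monotone_on_def intro: mult_left_mono)
    qed (use q_level(2) in auto)
    finally show ?thesis .
  qed
  have "\<sigma>\<^sup>2 * blocks_running_max_bound n k w = (\<Sum>b\<in>{1..k}. \<sigma>\<^sup>2 * running_max_bound (piece n k b) (num_pieces n k) w)"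
    unfolding blocks_running_max_bound_def by (simp add: sum_distrib_left)
  also have "\<dots> \<le> sqdist_n n (iso_est n x) ?ts"
    unfolding split using block by (intro sum_mono) auto
  finally show ?thesis unfolding w_def .
qed

lemma blocks_running_max_bound_integral:
  shows "integrable (std_normal_PiM {1..n}) (blocks_running_max_bound n k)"
    and "real k * real (num_pieces n k) / 5 \<le> (\<integral>z. blocks_running_max_bound n k z \<partial>std_normal_PiM {1..n})"
proof -
  show "integrable (std_normal_PiM {1..n}) (blocks_running_max_bound n k)"
    unfolding blocks_running_max_bound_def[abs_def]
    by (intro Bochner_Integration.integrable_sum running_max_bound_pieces(1)[OF k1 kn]) auto
  have "real k * real (num_pieces n k) / 5 = (\<Sum>b\<in>{1..k}. real (num_pieces n k) / 5)" by simp
  also have "\<dots> \<le> (\<Sum>b\<in>{1..k}. (\<integral>z. running_max_bound (piece n k b) (num_pieces n k) z \<partial>std_normal_PiM {1..n}))"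
    by (intro sum_mono running_max_bound_pieces(2)[OF k1 kn]) auto
  also have "\<dots> = (\<integral>z. blocks_running_max_bound n k z \<partial>std_normal_PiM {1..n})"
    unfolding blocks_running_max_bound_def
    by (intro Bochner_Integration.integral_sum[symmetric] running_max_bound_pieces(1)[OF k1 kn]) auto
  finally show "real k * real (num_pieces n k) / 5 \<le> (\<integral>z. blocks_running_max_bound n k z \<partial>std_normal_PiM {1..n})" .
qed

end

definition iso_risk :: "nat \<Rightarrow> real \<Rightarrow> (nat \<Rightarrow> real) \<Rightarrow> ennreal" where
  "iso_risk n \<sigma> \<theta> = (\<integral>\<^sup>+ x. ennreal (sqdist_n n (iso_est n x) \<theta>) \<partial>gauss_n n \<theta> \<sigma>)"

context
  fixes n k :: nat and \<sigma> :: real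
  assumes k1: "1 \<le> k" and kn: "k \<le> n" and \<sigma>: "\<sigma> > 0"
begin

lemma truncated_bound_le_iso_risk:
  "(\<integral>\<^sup>+ z. (if \<forall>i\<in>{1..n}. \<sigma> * \<bar>z i\<bar> < real N / 2
               then ennreal (\<sigma>\<^sup>2 * blocks_running_max_bound n k z) else 0) \<partial>std_normal_PiM {1..n})
     \<le> iso_risk n \<sigma> (staircase n k (real N))"
proof -
  let ?I = "{1..n}" and ?\<theta> = "staircase n k (real N)"
  let ?T = "\<lambda>z. \<lambda>i\<in>?I. ?\<theta> i + \<sigma> * z i"
  define g where "g x = (if \<forall>i\<in>?I. \<bar>x i - ?\<theta> i\<bar> < real N / 2
      then ennreal (\<sigma>\<^sup>2 * blocks_running_max_bound n k (\<lambda>i. (x i - ?\<theta> i) / \<sigma>)) else 0)" for x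
  have [measurable]: "i \<in> ?I \<Longrightarrow> (\<lambda>x. x i) \<in> borel_measurable (gauss_n n ?\<theta> \<sigma>)" for i
    by (rule measurable_gauss_n_coord)
  have [measurable]: "(\<lambda>x. blocks_running_max_bound n k (\<lambda>i. (x i - ?\<theta> i) / \<sigma>)) \<in> borel_measurable (gauss_n n ?\<theta> \<sigma>)"
    by (intro borel_measurable_blocks_running_max_bound ballI borel_measurable_divide
        borel_measurable_diff measurable_gauss_n_coord) auto
  have g_meas: "g \<in> borel_measurable (gauss_n n ?\<theta> \<sigma>)" unfolding g_def by measurable
  have T_meas: "?T \<in> measurable (std_normal_PiM ?I) (gauss_n n ?\<theta> \<sigma>)"
    unfolding gauss_n_def
    by (intro measurable_restrict) (auto intro!: measurable_compose[OF measurable_component_singleton])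
  have "(\<integral>\<^sup>+ z. (if \<forall>i\<in>?I. \<sigma> * \<bar>z i\<bar> < real N / 2
               then ennreal (\<sigma>\<^sup>2 * blocks_running_max_bound n k z) else 0) \<partial>std_normal_PiM ?I)
      = (\<integral>\<^sup>+ z. g (?T z) \<partial>std_normal_PiM ?I)"
  proof (intro nn_integral_cong)
    fix z :: "nat \<Rightarrow> real"
    have "blocks_running_max_bound n k (\<lambda>i. (?T z i - ?\<theta> i) / \<sigma>) = blocks_running_max_bound n k z"
      using \<sigma> by (intro blocks_running_max_bound_cong) auto
    then show "(if \<forall>i\<in>?I. \<sigma> * \<bar>z i\<bar> < real N / 2
               then ennreal (\<sigma>\<^sup>2 * blocks_running_max_bound n k z) else 0) = g (?T z)"
      unfolding g_def using \<sigma> by (simp add: abs_mult)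
  qed
  also have "\<dots> = (\<integral>\<^sup>+ x. g x \<partial>distr (std_normal_PiM ?I) (gauss_n n ?\<theta> \<sigma>) ?T)"
    by (rule nn_integral_distr[symmetric, OF T_meas]) (use g_meas in simp)
  also have "\<dots> = (\<integral>\<^sup>+ x. g x \<partial>gauss_n n ?\<theta> \<sigma>)"
    using gauss_n_eq_distr_std_normal[OF \<sigma>] by simp
  also have "\<dots> \<le> iso_risk n \<sigma> ?\<theta>"
    unfolding iso_risk_def g_def
    using iso_est_sqdist_ge[OF k1 kn \<sigma>] by (intro nn_integral_mono) (simp add: ennreal_leI)
  finally show ?thesis .
qed

lemma iso_risk_ge:
  "ennreal (\<sigma>\<^sup>2 * (real k * real (num_pieces n k) / 5)) \<le> (SUP \<theta>\<in>Theta_up n k. iso_risk n \<sigma> \<theta>)"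
proof -
  let ?I = "{1..n}" and ?M = "std_normal_PiM {1..n}"
  define h where "h N z = (if \<forall>i\<in>?I. \<sigma> * \<bar>z i\<bar> < real N / 2
      then ennreal (\<sigma>\<^sup>2 * blocks_running_max_bound n k z) else 0)" for N :: nat and z
  have [measurable]: "i \<in> ?I \<Longrightarrow> (\<lambda>z. z i) \<in> borel_measurable ?M" for i
    by (rule measurable_std_normal_PiM_coord)
  have [measurable]: "blocks_running_max_bound n k \<in> borel_measurable ?M"
    using borel_measurable_blocks_running_max_bound[of n "\<lambda>z. z"] measurable_std_normal_PiM_coord by simp
  have h_meas: "h N \<in> borel_measurable ?M" for N unfolding h_def by measurable
  have inc: "incseq h"
  proof (rule incseq_SucI, rule le_funI)
    fix N z show "h N z \<le> h (Suc N) z" unfolding h_def by (auto simp: not_less)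
  qed
  have sup: "(SUP N. h N z) = ennreal (\<sigma>\<^sup>2 * blocks_running_max_bound n k z)" for z
  proof (rule antisym)
    show "(SUP N. h N z) \<le> ennreal (\<sigma>\<^sup>2 * blocks_running_max_bound n k z)"
      unfolding h_def by (intro SUP_least) auto
    obtain N :: nat where N: "real N > 2 * \<sigma> * (\<Sum>i\<in>?I. \<bar>z i\<bar>)" using reals_Archimedean2 by blast
    have "\<sigma> * \<bar>z i\<bar> < real N / 2" if "i \<in> ?I" for i
    proof -
      have "\<sigma> * \<bar>z i\<bar> \<le> \<sigma> * (\<Sum>i\<in>?I. \<bar>z i\<bar>)"
        using \<sigma> that by (intro mult_left_mono member_le_sum) auto
      then show ?thesis using N by linarith
    qed
    then have "h N z = ennreal (\<sigma>\<^sup>2 * blocks_running_max_bound n k z)" unfolding h_def by simp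
    then show "ennreal (\<sigma>\<^sup>2 * blocks_running_max_bound n k z) \<le> (SUP N. h N z)"
      by (metis SUP_upper UNIV_I)
  qed
  have "(\<integral>\<^sup>+ z. ennreal (\<sigma>\<^sup>2 * blocks_running_max_bound n k z) \<partial>?M) = (SUP N. \<integral>\<^sup>+ z. h N z \<partial>?M)"
    unfolding sup[symmetric] by (rule nn_integral_monotone_convergence_SUP[OF inc h_meas])
  also have "\<dots> \<le> (SUP \<theta>\<in>Theta_up n k. iso_risk n \<sigma> \<theta>)"
  proof (rule SUP_least)
    fix N :: nat
    have "staircase n k (real N) \<in> Theta_up n k" by (rule staircase_in_Theta_up[OF k1 kn]) simp
    then show "(\<integral>\<^sup>+ z. h N z \<partial>?M) \<le> (SUP \<theta>\<in>Theta_up n k. iso_risk n \<sigma> \<theta>)"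
      unfolding h_def by (rule SUP_upper2) (rule truncated_bound_le_iso_risk)
  qed
  finally have risk: "(\<integral>\<^sup>+ z. ennreal (\<sigma>\<^sup>2 * blocks_running_max_bound n k z) \<partial>?M)
      \<le> (SUP \<theta>\<in>Theta_up n k. iso_risk n \<sigma> \<theta>)" .
  have int: "integrable ?M (\<lambda>z. \<sigma>\<^sup>2 * blocks_running_max_bound n k z)"
    using blocks_running_max_bound_integral(1)[OF k1 kn] by simp
  have "\<sigma>\<^sup>2 * (real k * real (num_pieces n k) / 5) \<le> (\<integral>z. \<sigma>\<^sup>2 * blocks_running_max_bound n k z \<partial>?M)"
    using blocks_running_max_bound_integral(2)[OF k1 kn] \<sigma> by (simp add: mult_left_mono)
  also have "\<dots> \<le> (\<integral>z. max 0 (\<sigma>\<^sup>2 * blocks_running_max_bound n k z) \<partial>?M)"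
    using int by (intro integral_mono) auto
  finally have "ennreal (\<sigma>\<^sup>2 * (real k * real (num_pieces n k) / 5))
      \<le> ennreal (\<integral>z. max 0 (\<sigma>\<^sup>2 * blocks_running_max_bound n k z) \<partial>?M)"
    by (rule ennreal_leI)
  also have "\<dots> = (\<integral>\<^sup>+ z. max 0 (\<sigma>\<^sup>2 * blocks_running_max_bound n k z) \<partial>?M)"
    using int by (intro nn_integral_eq_integral[symmetric]) auto
  also have "\<dots> = (\<integral>\<^sup>+ z. ennreal (\<sigma>\<^sup>2 * blocks_running_max_bound n k z) \<partial>?M)"
    by (intro nn_integral_cong) (simp add: ennreal_max_0)
  finally show ?thesis using risk by (rule order.trans)
qed

end

lemma ln_le_num_pieces:
  assumes k1: "1 \<le> k" and kn: "k \<le> n"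
  shows "ln (exp 1 * real n / real k) \<le> 9 * real (num_pieces n k)"
proof -
  let ?m = "real (block_len n k)" and ?L = "real (num_pieces n k)"
  have m1: "1 \<le> ?m" using block_len_pos[OF k1 kn] by simp
  have "n < k * (block_len n k + 1)"
  proof -
    have "n mod k < k" using k1 by simp
    then have "n < n div k * k + k" using div_mult_mod_eq[of n k] by linarith
    then show ?thesis unfolding block_len_def by (simp add: algebra_simps)
  qed
  then have "real n < real k * (?m + 1)" by (metis of_nat_1 of_nat_add of_nat_less_iff of_nat_mult)
  then have "real n / real k < ?m + 1" using k1 by (simp add: field_simps)
  then have nk: "real n / real k \<le> 2 * ?m" using m1 by linarith
  have nk_pos: "0 < real n / real k" using k1 kn by simp
  have ln128: "ln (128::real) = 7 * ln 2" using ln_realpow[of 2 7] by simp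
  have "ln (exp 1 * (real n / real k)) = ln (exp 1) + ln (real n / real k)"
    using nk_pos by (intro ln_mult_pos) auto
  then have "ln (exp 1 * real n / real k) = 1 + ln (real n / real k)" by simp
  also have "\<dots> \<le> 1 + ln (2 * ?m)" using nk nk_pos by simp
  also have "\<dots> = 1 + ln 2 + ln ?m" using m1 by (simp add: ln_mult)
  also have "\<dots> < 1 + ln 2 + ?L * (7 * ln 2)" using ln_block_len_less[OF k1 kn] ln128 by simp
  also have "\<dots> \<le> 9 * ?L"
  proof -
    have "1 \<le> ?L" unfolding num_pieces_def by simp
    moreover have "?L * (7 * ln 2) \<le> ?L * 7" using ln_2_less_1 \<open>1 \<le> ?L\<close> by (intro mult_left_mono) auto
    ultimately show ?thesis using ln_2_less_1 by linarith
  qed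
  finally show ?thesis by simp
qed

theorem mainTheorem2:
  shows "\<exists>c>0. \<forall>(\<sigma>::real) (n::nat) (k::nat). \<sigma> > 0 \<and> 1 \<le> k \<and> k \<le> n \<longrightarrow>
    (SUP \<theta>\<in>Theta_up n k. \<integral>\<^sup>+ x. ennreal (sqdist_n n (iso_est n x) \<theta>) \<partial>gauss_n n \<theta> \<sigma>)
      \<ge> ennreal (c * \<sigma>\<^sup>2 * real k * ln (exp 1 * real n / real k))"
proof (intro exI[of _ "1/45"] conjI allI impI)
  fix \<sigma> :: real and n k :: nat
  assume "\<sigma> > 0 \<and> 1 \<le> k \<and> k \<le> n"
  then have \<sigma>: "\<sigma> > 0" and k1: "1 \<le> k" and kn: "k \<le> n" by auto
  have "1/45 * \<sigma>\<^sup>2 * real k * ln (exp 1 * real n / real k) = \<sigma>\<^sup>2 * real k / 45 * ln (exp 1 * real n / real k)"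
    by simp
  also have "\<dots> \<le> \<sigma>\<^sup>2 * real k / 45 * (9 * real (num_pieces n k))"
    using ln_le_num_pieces[OF k1 kn] by (intro mult_left_mono) auto
  also have "\<dots> = \<sigma>\<^sup>2 * (real k * real (num_pieces n k) / 5)" by simp
  finally have "ennreal (1/45 * \<sigma>\<^sup>2 * real k * ln (exp 1 * real n / real k))
      \<le> (SUP \<theta>\<in>Theta_up n k. iso_risk n \<sigma> \<theta>)"
    using iso_risk_ge[OF k1 kn \<sigma>] by (meson ennreal_leI order.trans)
  then show "(SUP \<theta>\<in>Theta_up n k. \<integral>\<^sup>+ x. ennreal (sqdist_n n (iso_est n x) \<theta>) \<partial>gauss_n n \<theta> \<sigma>)
      \<ge> ennreal (1/45 * \<sigma>\<^sup>2 * real k * ln (exp 1 * real n / real k))"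
    unfolding iso_risk_def .
qed simp

end
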